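(* Let $K$ be a field of characteristic $0$, let $K_2$ be the algebra of $2\times 2$ matrices over $K$ and let $H(K_2)$ be the Jordan algebra of symmetric matrices in $K_2$. Then the standard polynomial $$S_4(x_1,x_2,x_3,x_4)=\sum_{\sigma\in \mathrm{Sym}(4)}(-1)^{\sigma}x_{\sigma(1)}x_{\sigma(2)}x_{\sigma(3)}x_{\sigma(4)}$$ and the metabelian polynomial $$[[x_1,x_2],[x_3,x_4]]$$ form a basis of the weak identities of the pair $(K_2,H(K_2))$; that is, they generate $T(K_2,H(K_2))$ as a weak T-ideal.
   Context: All associative and Jordan algebras are unitary and over $K$. $A$ is the free unitary associative $K$-algebra on the countable set $x_1,x_2,\ldots$. Notation: $[a,b]=ab-ba$, $a\circ b=ab+ba$; $(-1)^\sigma$ is the sign of $\sigma$. $SJ\subset A$ is the free special Jordan algebra, i.e. the smallest subspace of $A$ containing $1,x_1,x_2,\ldots$ and closed under $\circ$. If $G$ is a special Jordan algebra with associative enveloping algebra $R$ (so $G\subseteq R$ is a subspace containing $1$, closed under $\circ$, and generating $R$ as an associative algebra), a polynomial $f(x_1,\ldots,x_n)\in A$ is a weak identity of the pair $(R,G)$ if $f(g_1,\ldots,g_n)=0$ for all $g_1,\ldots,g_n\in G$. $T(R,G)\subseteq A$ is the set of all weak identities of $(R,G)$. A set of polynomials $\{f_i(x_1,\ldots,x_{n_i})\}$ generates $T(R,G)$ as a weak T-ideal (is a basis of it) if $T(R,G)$ is the two-sided ideal of $A$ generated by all $f_i(u_1,\ldots,u_{n_i})$ with $u_1,\ldots,u_{n_i}\in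 SJ$. *)

theory Defs
  imports
    "HOL-Analysis.Analysis"
    "HOL-Library.Poly_Mapping"
    "HOL-Combinatorics.Permutations"
begin

text \<open>
  The free unitary associative algebra is the monoid algebra of the free monoid on a countable
  set, i.e. the convolution ring of finitely supported functions on words.  Since
  \<^typ>\<open>'m \<Rightarrow>\<^sub>0 'k\<close> expects an additive monoid of exponents, concatenation of words is written
  as (noncommutative) addition.
\<close>

datatype free_monoid = Word (letters: "nat list")

instantiation free_monoid :: monoid_add
begin

definition zero_free_monoid :: free_monoid where
  "0 = Word []"

definition plus_free_monoid :: "free_monoid \<Rightarrow> free_monoid \<Rightarrow> free_monoid" where
  "u + v = Word (letters u @ letters v)"

instance
  by standard (simp_all add: zero_free_monoid_def plus_free_monoid_def)

end

type_synonym 'k free_alg = "free_monoid \<Rightarrow>\<^sub>0 'k"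

definition scalar :: "'k::field \<Rightarrow> 'k free_alg" where
  "scalar c = Poly_Mapping.single 0 c"

text \<open>Generators are numbered from 0: the variable $x_{i+1}$ is \<open>X i\<close>.\<close>

definition X :: "nat \<Rightarrow> 'k::field free_alg" where
  "X i = Poly_Mapping.single (Word [i]) 1"

definition commutator :: "'a::ring \<Rightarrow> 'a \<Rightarrow> 'a" where
  "commutator a b = a * b - b * a"

definition jordan :: "'a::ring \<Rightarrow> 'a \<Rightarrow> 'a" where
  "jordan a b = a * b + b * a"

inductive_set SJ :: "'k::field free_alg set" where
  one: "1 \<in> SJ"
| gen: "X i \<in> SJ"
| add: "f \<in> SJ \<Longrightarrow> g \<in> SJ \<Longrightarrow> f + g \<in> SJ"
| scale: "f \<in> SJ \<Longrightarrow> scalar c * f \<in> SJ"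
| jordan: "f \<in> SJ \<Longrightarrow> g \<in> SJ \<Longrightarrow> jordan f g \<in> SJ"

definition subst :: "(nat \<Rightarrow> 'k::field free_alg) \<Rightarrow> 'k free_alg \<Rightarrow> 'k free_alg" where
  "subst u f = (\<Sum>w\<in>Poly_Mapping.keys f.
     scalar (Poly_Mapping.lookup f w) * prod_list (map u (letters w)))"

text \<open>
  On \<^typ>\<open>'k^'n^'n\<close> the class operation \<open>*\<close> is componentwise; the algebra of square matrices
  is given by \<open>**\<close>, with unit \<open>mat 1\<close> and scalars \<open>mat c\<close>.
\<close>

definition mat_eval :: "(nat \<Rightarrow> 'k^'n^'n) \<Rightarrow> 'k::field free_alg \<Rightarrow> 'k^'n^'n" where
  "mat_eval g f = (\<Sum>w\<in>Poly_Mapping.keys f.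
     mat (Poly_Mapping.lookup f w) ** foldr (\<lambda>i M. g i ** M) (letters w) (mat 1))"

text \<open>Weak identities of the pair consisting of the full matrix algebra and \<open>G\<close>.\<close>

definition weak_identities :: "('k::field^'n^'n) set \<Rightarrow> 'k free_alg set" where
  "weak_identities G = {f. \<forall>g. (\<forall>i. g i \<in> G) \<longrightarrow> mat_eval g f = 0}"

definition symmetric_matrices :: "('k::field^'n^'n) set" where
  "symmetric_matrices = {M. transpose M = M}"

definition two_sided_ideal :: "'a::ring_1 set \<Rightarrow> bool" where
  "two_sided_ideal I \<longleftrightarrow> 0 \<in> I \<and> (\<forall>a\<in>I. \<forall>b\<in>I. a + b \<in> I) \<and>
     (\<forall>a\<in>I. \<forall>r. r * a \<in> I \<and> a * r \<in> I)"

definition weak_T_ideal :: "'k::field free_alg set \<Rightarrow> 'k free_alg set" where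
  "weak_T_ideal F = two_sided_ideal hull {subst u f | u f. f \<in> F \<and> (\<forall>i. u i \<in> SJ)}"

definition standard_poly :: "nat \<Rightarrow> 'k::field free_alg" where
  "standard_poly n = (\<Sum>\<sigma> | \<sigma> permutes {..<n}.
     of_int (sign \<sigma>) * prod_list (map (\<lambda>i. X (\<sigma> i)) [0..<n]))"

definition metabelian_poly :: "'k::field free_alg" where
  "metabelian_poly = commutator (commutator (X 0) (X 1)) (commutator (X 2) (X 3))"

end

theory Submission
  imports Defs
begin

text \<open>
  Symmetric matrices of order two are the scalars plus a plane \<open>V\<close>, and \<open>x y z = z y x\<close> on \<open>V\<close>.  In the
  quotient of the free algebra by the weak T-ideal, let \<open>J\<close> be the image of the special Jordan
  elements.  Every \<open>c = [a, b]\<close> with \<open>a, b\<close> in \<open>J\<close> behaves like a multiple of a fixed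
  skew matrix: the maps \<open>c \<mapsto> c x + x c\<close> act like multiplication by the trace of \<open>x\<close>, so they commute, and
  left multiplications by traceless parts satisfy \<open>x y z = z y x\<close>.  Hence the commutator ideal is spanned by
  the elements \<open>w c\<close> with \<open>w\<close> a word and \<open>c = [x\<^sub>i, x\<^sub>j]\<close> multiplied by traces.  Up to shorter words,
  letters of \<open>w\<close> may be permuted within the odd and within the even places, and the Jacobi and standard
  identities allow to exchange a letter with \<open>i\<close> or \<open>j\<close>.  After a change of the quadratic form \<open>x\<^sub>k\<close> can be
  evaluated at the matrix with entries \<open>t\<^sub>k, p\<^sub>k, q\<^sub>k, t\<^sub>k\<close>; then \<open>w [x\<^sub>i, x\<^sub>j]\<close> has a leading
  monomial with factor \<open>p\<^sub>i q\<^sub>j\<close>, and elements with the same leading monomial agree modulo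
  smaller ones.  So evaluation is injective on the quotient.
\<close>

section \<open>Metabelian Jordan pairs\<close>

text \<open>The trace of an element of \<open>J\<close> is not an element of the quotient; it exists
  there only through its action \<open>jordan c x\<close> on commutators. So a letter cannot be
  split into a scalar and a traceless part, and every relation of the plane \<open>V\<close> comes
  with correction terms in which a letter of the word has turned into such a trace. Within a Jordan
  pair these terms are computed exactly; later it only matters that their words are shorter.
  Symmetric matrices carry the form a^2 + b^2 on \<open>V\<close>. For the split form p q, the
  product of traceless parts along a word is a single monomial, alternating between p and q, and it
  records exactly what reversals of triples leave fixed: the letters in odd and in even places. This
  is the reason to change the form, although a conjugation doing so may need a square root of -1
  outside the field. Scalar matrices already force a weak identity into the commutator ideal, and
  only there are the elements \<open>w c\<close> compared. Monomials are encoded as powers of one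
  variable whose exponents are read digit by digit, so that univariate polynomials suffice.\<close>

primrec jordans :: "'a::ring \<Rightarrow> 'a list \<Rightarrow> 'a" where
  "jordans u [] = u"
| "jordans u (x # xs) = jordans (jordan u x) xs"

lemma jordans_snoc: "jordans u (xs @ [x]) = jordan (jordans u xs) x"
  by (induction xs arbitrary: u) simp_all

lemma jordans_add: "jordans (u + v) xs = jordans u xs + jordans v xs"
proof (induction xs arbitrary: u v)
  case (Cons x xs)
  have "jordan (u + v) x = jordan u x + jordan v x"
    by (simp add: jordan_def algebra_simps)
  with Cons show ?case by simp
qed simp

lemma jordans_minus: "jordans (- u) xs = - jordans u xs"
  using jordans_add[of u "- u" xs] jordans_add[of 0 0 xs] by (simp add: add_eq_0_iff)

lemma jordan_minus_left: "jordan (- u) x = - jordan u x"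
  by (simp add: jordan_def)

lemma jordans_0: "jordans 0 xs = 0"
  using jordans_add[of 0 0 xs] by simp

text \<open>The ring carries no scalars here, so characteristic zero appears as absence of torsion.
  \<open>standard_four\<close> is the standard polynomial of degree four, rewritten in
  commutators.\<close>

locale jordan_pair =
  fixes J :: "'r::ring_1 set"
  assumes torsion_free: "n > 0 \<Longrightarrow> of_nat n * (x :: 'r) = 0 \<Longrightarrow> x = 0"
    and J_minus: "a \<in> J \<Longrightarrow> b \<in> J \<Longrightarrow> a - b \<in> J"
    and J_jordan: "a \<in> J \<Longrightarrow> b \<in> J \<Longrightarrow> jordan a b \<in> J"
    and metabelian: "a \<in> J \<Longrightarrow> b \<in> J \<Longrightarrow> c \<in> J \<Longrightarrow> d \<in> J \<Longrightarrow>
      commutator (commutator a b) (commutator c d) = 0"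
    and standard_four: "a \<in> J \<Longrightarrow> b \<in> J \<Longrightarrow> c \<in> J \<Longrightarrow> d \<in> J \<Longrightarrow>
      jordan (commutator a b) (commutator c d) + jordan (commutator b c) (commutator a d)
        + jordan (commutator c a) (commutator b d) = 0"
begin

section \<open>Basic rules for commutators and Jordan products\<close>

lemma double_eq_0: "x + x = 0 \<Longrightarrow> x = (0::'r)"
  using torsion_free[of 2 x] by (simp add: mult_2)

lemma eq_minus_self_eq_0: "x = - x \<Longrightarrow> x = (0::'r)"
  by (rule double_eq_0) (simp only: eq_neg_iff_add_eq_0)

lemma triple_eq_0: "x + x + x = 0 \<Longrightarrow> x = (0::'r)"
  using torsion_free[of "Suc (Suc (Suc 0))" x]
  by (simp only: of_nat_Suc of_nat_0 distrib_right mult_1 mult_zero_left add_0_left add_0_right add.assoc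
      zero_less_Suc)

lemma commutator_swap: "commutator a b = - commutator b (a::'r)"
  by (simp add: commutator_def)

lemma commutator_add_right: "commutator x (a + b) = commutator x a + commutator x (b::'r)"
  by (simp add: commutator_def algebra_simps)

lemma jordan_commute: "jordan a b = jordan b (a::'r)"
  by (simp add: jordan_def)

lemma double_commutator_jordan:
  "commutator (commutator a b) c = jordan a (jordan b c) - jordan b (jordan a (c::'r))"
  by (simp add: commutator_def jordan_def algebra_simps)

lemma double_commutator_in_J:
  "a \<in> J \<Longrightarrow> b \<in> J \<Longrightarrow> c \<in> J \<Longrightarrow> commutator (commutator a b) c \<in> J"
  by (simp add: double_commutator_jordan J_minus J_jordan)

lemma commutator_jordan_right:
  "commutator a (jordan b c) = jordan (commutator a c) b + jordan (commutator a b) (c::'r)"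
  by (simp add: commutator_def jordan_def algebra_simps)

lemma commutator_jordan_left:
  "commutator (jordan b c) a = jordan (commutator b a) c + jordan (commutator c a) (b::'r)"
  by (simp add: commutator_def jordan_def algebra_simps)

lemma jordan_jordan_diff:
  "jordan (jordan u x) y - jordan (jordan u y) x = commutator u (commutator x (y::'r))"
  by (simp add: commutator_def jordan_def algebra_simps)

text \<open>
  The expression vanishing here is alternating in \<open>c\<close>, \<open>d\<close>, \<open>e\<close>; together with the Jacobi
  identity this makes its values on five letters a function on the edges of the complete graph
  with zero sum over every triangle, and such a function is zero.
\<close>

lemma jordan_double_commutator:
  assumes J: "a \<in> J" "b \<in> J" "c \<in> J" "d \<in> J" "e \<in> J"
  shows "jordan (commutator (commutator a b) c) (commutator d e) = 0"
proof -
  define f where "f a b c d e = jordan (commutator (commutator a b) c) (commutator d (e::'r))"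
    for a b c d e
  have skew: "f a b c d e + f a b d c e = 0"
    if "a \<in> J" "b \<in> J" "c \<in> J" "d \<in> J" "e \<in> J" for a b c d e
  proof -
    \<comment> \<open>The commutator with \<open>commutator a b\<close> is a derivation; it is
      applied to \<open>commutator (jordan c d) e\<close> expanded by the product rule.\<close>
    have "f a b c d e + f a b d c e = commutator (commutator a b) (commutator (jordan c d) e)
       - jordan c (commutator (commutator a b) (commutator d e))
       - jordan d (commutator (commutator a b) (commutator c e))"
      by (simp add: f_def commutator_def jordan_def algebra_simps)
    also have "\<dots> = 0"
      using that by (simp add: metabelian J_jordan) (simp add: jordan_def)
    finally show ?thesis .
  qed
  have sw: "f a b d e c = - f a b d c e" for a b c d e
    by (simp add: f_def commutator_def jordan_def algebra_simps)
  have swl: "f b a c d e = - f a b c d e" for a b c d e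
    by (simp add: f_def commutator_def jordan_def algebra_simps)
  have jac: "f a b c d e + f b c a d e + f c a b d e = 0" for a b c d e
    by (simp add: f_def commutator_def jordan_def algebra_simps)
  have skew': "f a b d c e = - f a b c d e"
    if "a \<in> J" "b \<in> J" "c \<in> J" "d \<in> J" "e \<in> J" for a b c d e
    using skew[OF that] by (simp add: add_eq_0_iff)
  have star: "f a b c d e + f a c d b e + f a d b c e = 0"
    if J: "a \<in> J" "b \<in> J" "c \<in> J" "d \<in> J" "e \<in> J" for a b c d e
  proof (rule double_eq_0)
    have 1: "f c a b d e = f a c d b e" "f d a c b e = f a d b c e" "f b a d c e = f a b c d e"
      using J by (metis swl skew' minus_minus)+
    have 2: "f b c d a e = - f b c a d e" "f c d b a e = - f c d a b e" "f d b c a e = - f d b a c e"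
      using J by (metis skew')+
    \<comment> \<open>The Jacobi identities of the four triples among \<open>a\<close>,
      \<open>b\<close>, \<open>c\<close>, \<open>d\<close> are added, with \<open>e\<close> staying
      last. Skewness cancels the terms that do not start with \<open>a\<close> up to order and
      doubles the others.\<close>
    have "(f a b c d e + f a c d b e + f a d b c e) + (f a b c d e + f a c d b e + f a d b c e)
      = (f a b c d e + f b c a d e + f c a b d e) + (f a c d b e + f c d a b e + f d a c b e)
        + (f a d b c e + f d b a c e + f b a d c e)
        + (f b c d a e + f c d b a e + f d b c a e)"
      by (simp add: 1 2 algebra_simps)
    also have "\<dots> = 0"
      by (simp add: jac)
    finally show "(f a b c d e + f a c d b e + f a d b c e) + (f a b c d e + f a c d b e + f a d b c e) = 0" .
  qed
  have far: "f a d b c e = - f a e b c d"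
    if J: "a \<in> J" "b \<in> J" "c \<in> J" "d \<in> J" "e \<in> J" for a b c d e
  proof -
    have 1: "f a b c e d = - f a b c d e"
      by (rule sw)
    have 2: "f a c e b d = - f a c d b e"
      using J by (metis sw skew' minus_minus)
    have "f a d b c e + f a e b c d = (f a b c d e + f a c d b e + f a d b c e)
       + (f a b c e d + f a c e b d + f a e b c d)"
      by (simp add: 1 2)
    also have "\<dots> = 0"
      using J by (simp add: star)
    finally show ?thesis by (simp add: add_eq_0_iff2)
  qed
  have "f a c d b e = f a b c d e" "f a d b c e = f a b c d e"
    using J by (metis far sw skew' minus_minus)+
  then have "f a b c d e + f a b c d e + f a b c d e = 0"
    using star[OF J] by simp
  then have "f a b c d e = 0"
    by (rule triple_eq_0)
  then show ?thesis by (simp add: f_def)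
qed


text \<open>\<open>U\<close> stands for the skew matrices: commutators multiplied by traces. Sums
  are left out so that each element is one iterated Jordan product starting from a single
  commutator.\<close>

inductive_set U :: "'r set" where
  commutator: "a \<in> J \<Longrightarrow> b \<in> J \<Longrightarrow> commutator a b \<in> U"
| jordan: "u \<in> U \<Longrightarrow> x \<in> J \<Longrightarrow> jordan u x \<in> U"

text \<open>The two relations need a joint induction: for \<open>jordan u x\<close>, each of them
  reduces to instances of both for \<open>u\<close>.\<close>

lemma U_relations:
  assumes "u \<in> U"
  shows U_commutator: "a \<in> J \<Longrightarrow> b \<in> J \<Longrightarrow> commutator u (commutator a b) = 0"
    and U_jordan_double_commutator:
      "a \<in> J \<Longrightarrow> b \<in> J \<Longrightarrow> c \<in> J \<Longrightarrow> jordan u (commutator (commutator a b) c) = 0"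
proof -
  have "(\<forall>a\<in>J. \<forall>b\<in>J. commutator u (commutator a b) = 0) \<and>
    (\<forall>a\<in>J. \<forall>b\<in>J. \<forall>c\<in>J. jordan u (commutator (commutator a b) c) = 0)"
    using assms
  proof induction
    case (commutator a b)
    then show ?case
      by (simp add: metabelian jordan_double_commutator jordan_commute[of "commutator a b"])
  next
    case (jordan u x)
    have 1: "commutator (jordan u x) (commutator a b) = 0" if "a \<in> J" "b \<in> J" for a b
    proof -
      have "commutator (jordan u x) (commutator a b)
        = jordan x (commutator u (commutator a b)) - jordan u (commutator (commutator a b) x)"
        by (simp add: commutator_def jordan_def algebra_simps)
      moreover have "commutator u (commutator a b) = 0" "jordan u (commutator (commutator a b) x) = 0"
        using jordan that by blast+
      ultimately show ?thesis
        by (simp add: jordan_def[of x])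
    qed
    have 2: "jordan (jordan u x) (commutator (commutator a b) c) = 0"
      if "a \<in> J" "b \<in> J" "c \<in> J" for a b c
    proof -
      let ?y = "commutator (commutator a b) c"
      have "jordan (jordan u x) ?y = jordan (jordan u ?y) x + commutator u (commutator x ?y)"
        using jordan_jordan_diff[of u x ?y] by (simp add: algebra_simps)
      \<comment> \<open>\<open>?y\<close> lies in \<open>J\<close> as a double commutator, so the
        first relation for \<open>u\<close> covers \<open>commutator x ?y\<close>.\<close>
      moreover have "jordan u ?y = 0" "commutator u (commutator x ?y) = 0"
        using jordan that double_commutator_in_J[OF that] by blast+
      ultimately show ?thesis
        by (simp add: jordan_def)
    qed
    from 1 2 show ?case by blast
  qed
  then show "a \<in> J \<Longrightarrow> b \<in> J \<Longrightarrow> commutator u (commutator a b) = 0"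
    and "a \<in> J \<Longrightarrow> b \<in> J \<Longrightarrow> c \<in> J \<Longrightarrow> jordan u (commutator (commutator a b) c) = 0"
    by blast+
qed

lemma U_mult_commutator:
  "u \<in> U \<Longrightarrow> a \<in> J \<Longrightarrow> b \<in> J \<Longrightarrow> u * commutator a b = commutator a b * u"
  using U_commutator[of u a b] by (simp add: commutator_def[of u])

lemma jordan_right_commute:
  "u \<in> U \<Longrightarrow> x \<in> J \<Longrightarrow> y \<in> J \<Longrightarrow> jordan (jordan u x) y = jordan (jordan u y) x"
  using jordan_jordan_diff[of u x y] U_commutator[of u x y] by simp

lemma jordans_in_U: "u \<in> U \<Longrightarrow> set xs \<subseteq> J \<Longrightarrow> jordans u xs \<in> U"
  by (induction xs arbitrary: u) (auto intro: U.jordan)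

lemma jordans_Cons:
  "u \<in> U \<Longrightarrow> set xs \<subseteq> J \<Longrightarrow> x \<in> J \<Longrightarrow> jordans u (x # xs) = jordan (jordans u xs) x"
proof (induction xs arbitrary: u)
  case (Cons y ys)
  then show ?case
    by (auto simp: jordan_right_commute[of u x y] U.jordan)
qed simp

lemma U_jordansE:
  assumes "u \<in> U"
  obtains i j xs where "i \<in> J" "j \<in> J" "set xs \<subseteq> J" "u = jordans (commutator i j) xs"
proof -
  have "\<exists>i\<in>J. \<exists>j\<in>J. \<exists>xs. set xs \<subseteq> J \<and> u = jordans (commutator i j) xs"
    using assms
  proof induction
    case (commutator a b)
    then show ?case
      by (intro bexI[of _ a] bexI[of _ b] exI[of _ "[]"]) simp_all
  next
    case (jordan u x)
    then obtain i j xs where "i \<in> J" "j \<in> J" "set xs \<subseteq> J" "u = jordans (commutator i j) xs"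
      by blast
    with \<open>x \<in> J\<close> show ?case
      by (intro bexI[of _ i] bexI[of _ j] exI[of _ "xs @ [x]"]) (simp_all add: jordans_snoc)
  qed
  with that show thesis by blast
qed

text \<open>By the metabelian identity commutators commute, so their Jordan products are twice their
  products. What remains of the standard identity is the Pluecker relation for 2 by 2
  minors.\<close>

lemma commutator_product_sum:
  assumes "a \<in> J" "b \<in> J" "c \<in> J" "d \<in> J"
  shows "commutator a b * commutator c d + commutator b c * commutator a d
    + commutator c a * commutator b d = 0"
proof (rule double_eq_0)
  have "commutator x y * commutator z w = commutator z w * commutator x y"
    if "x \<in> J" "y \<in> J" "z \<in> J" "w \<in> J" for x y z w
    using that by (intro U_mult_commutator U.commutator)
  then have "jordan (commutator x y) (commutator z w)
      = commutator x y * commutator z w + commutator x y * commutator z w"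
    if "x \<in> J" "y \<in> J" "z \<in> J" "w \<in> J" for x y z w
    using that by (simp add: jordan_def)
  then show "commutator a b * commutator c d + commutator b c * commutator a d
      + commutator c a * commutator b d
      + (commutator a b * commutator c d + commutator b c * commutator a d
      + commutator c a * commutator b d) = 0"
    using standard_four[OF assms] assms by (simp add: algebra_simps)
qed

text \<open>In the matrix picture a product of two skew matrices is a scalar. Here the derivation
  \<open>commutator x\<close> is applied to twice the product, and both resulting terms vanish by
  \<open>jordan_double_commutator\<close>.\<close>

lemma commutator_mult_commutator_central:
  assumes "a \<in> J" "b \<in> J" "x \<in> J" "i \<in> J" "j \<in> J"
  shows "commutator x (commutator a b * commutator i j) = 0"
proof -
  let ?p = "commutator a b" and ?c = "commutator i j"
  have pc: "?p * ?c = ?c * ?p"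
    using assms by (intro U_mult_commutator U.commutator)
  have "commutator x (?p * ?c) + commutator x (?p * ?c) = commutator x (?p * ?c + ?c * ?p)"
    by (simp add: pc) (simp add: commutator_def algebra_simps)
  also have "\<dots> = - jordan (commutator ?p x) ?c - jordan ?p (commutator ?c x)"
    by (simp add: commutator_def[of x] commutator_def[of _ x] jordan_def algebra_simps)
  also have "\<dots> = 0"
    using assms by (simp add: jordan_double_commutator jordan_commute[of ?p])
  finally show ?thesis
    by (rule double_eq_0)
qed

text \<open>
  Substituting \<open>jordan j y\<close> for \<open>j\<close> in the identity for a shorter list shows that the expression
  is skew in \<open>j\<close> and the first list element \<open>y\<close>.  Since the list elements may be permuted, it is
  zero as soon as the list has two elements.
\<close>

lemma commutator_mult_jordans_central:
  assumes "a \<in> J" "b \<in> J" "x \<in> J" "i \<in> J" "j \<in> J" "set xs \<subseteq> J"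
  shows "commutator x (commutator a b * jordans (commutator i j) xs) = 0"
  using assms(4-)
proof (induction "length xs" arbitrary: xs i j)
  case 0
  then show ?case
    by (simp add: assms commutator_mult_commutator_central)
next
  case (Suc n xs i j)
  obtain y ys where xs: "xs = y # ys" "length ys = n"
    using Suc.hyps(2) by (cases xs) auto
  note J = assms(1-3) Suc.prems(1,2)
  have y: "y \<in> J" and ys: "set ys \<subseteq> J"
    using Suc.prems xs by auto
  let ?p = "commutator a b"
  define G where "G y i j ys = commutator x (?p * jordans (commutator i j) (y # ys))" for y i j ys
  have swap: "G y j i ys = - G y i j ys" for y i j ys
    unfolding G_def commutator_swap[of j i] jordans_minus
    by (simp add: commutator_def[of x])
  have skew: "G y i j ys = - G j i y ys"
    if "y \<in> J" "i \<in> J" "j \<in> J" "set ys \<subseteq> J" "length ys = n" for y i j ys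
  proof -
    have "0 = commutator x (?p * jordans (commutator i (jordan j y)) ys)"
      using Suc.hyps(1)[of ys i "jordan j y"] that by (simp add: J_jordan)
    also have "\<dots> = G j i y ys + G y i j ys"
      by (simp add: G_def commutator_jordan_right jordans_add)
        (simp add: commutator_def[of x] algebra_simps)
    finally show ?thesis by (simp add: eq_neg_iff_add_eq_0 add.commute)
  qed
  have "G y i j ys = 0"
  proof (cases ys)
    case Nil
    \<comment> \<open>Skewness in \<open>j\<close>, \<open>y\<close> and in \<open>i\<close>,
      \<open>j\<close> makes \<open>G\<close> alternating, so its cyclic rotations agree. By the
      Jacobi identity their sum involves twice the products \<open>commutator i j * y\<close> added
      cyclically, and commuting \<open>x\<close> past these leaves an instance of
      \<open>commutator_product_sum\<close>.\<close>
    have "G i j y ys = G y i j ys"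
      using skew[of i j y ys] J y ys xs swap[of y j i ys] by simp
    moreover have "G j y i ys = G y i j ys"
      using skew[of y i j ys] J y ys xs swap[of j y i ys] by simp
    ultimately have "G y i j ys + G y i j ys + G y i j ys = G y i j ys + G i j y ys + G j y i ys"
      by simp
    also have "\<dots> = commutator x (?p * (jordan (commutator i j) y + jordan (commutator j y) i
        + jordan (commutator y i) j))"
      by (simp add: G_def Nil commutator_def[of x] algebra_simps)
    also have "jordan (commutator i j) y + jordan (commutator j y) i + jordan (commutator y i) j
      = (commutator i j * y + commutator j y * i + commutator y i * j)
        + (commutator i j * y + commutator j y * i + commutator y i * j)"
      by (simp add: commutator_def jordan_def algebra_simps)
    finally have "G y i j ys + G y i j ys + G y i j ys = commutator x (?p * \<dots>)" .
    moreover have "commutator x (?p * (commutator k l * z)) = - (?p * (commutator k l * commutator z x))"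
      if "k \<in> J" "l \<in> J" for k l z
    proof -
      have "commutator x (?p * (commutator k l * z))
        = commutator x (?p * commutator k l) * z - ?p * (commutator k l * commutator z x)"
        by (simp add: commutator_def[of x] commutator_def[of _ x] algebra_simps)
      then show ?thesis
        using that J by (simp add: commutator_mult_commutator_central)
    qed
    then have "commutator x (?p * (commutator i j * y + commutator j y * i + commutator y i * j))
      = - (?p * (commutator i j * commutator y x + commutator j y * commutator i x
        + commutator y i * commutator j x))"
      using J y by (simp add: distrib_left commutator_add_right)
    then have "commutator x (?p * (commutator i j * y + commutator j y * i + commutator y i * j)) = 0"
      using J y by (simp add: commutator_product_sum)
    ultimately have "G y i j ys + G y i j ys + G y i j ys = 0"
      by (simp add: distrib_left commutator_add_right)
    then show ?thesis
      by (rule triple_eq_0)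
  next
    case (Cons z zs)
    have zs: "z \<in> J" "set zs \<subseteq> J" "Suc (length zs) = n"
      using ys xs Cons by auto
    define H where "H y z i j = G y i j (z # zs)" for y z i j
    have sym: "H y z i j = H z y i j" if "y \<in> J" "z \<in> J" "i \<in> J" "j \<in> J" for y z i j
      using that by (simp add: H_def G_def jordan_right_commute[of _ y z] U.commutator)
    have sk: "H y z i j = - H j z i y" if "y \<in> J" "z \<in> J" "i \<in> J" "j \<in> J" for y z i j
      using skew[of y i j "z # zs"] that zs by (simp add: H_def)
    note J' = J y zs(1)
    have "H y z i j = - H j z i y"
      using J' by (intro sk)
    also have "H j z i y = H z j i y"
      using J' by (intro sym)
    also have "H z j i y = - H y j i z"
      using J' by (intro sk)
    also have "H y j i z = H j y i z"
      using J' by (intro sym)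
    also have "H j y i z = - H z y i j"
      using J' by (intro sk)
    also have "H z y i j = H y z i j"
      using J' by (intro sym)
    finally have "H y z i j = - H y z i j"
      by simp
    then have "H y z i j = 0"
      by (rule eq_minus_self_eq_0)
    then show ?thesis
      by (simp add: H_def Cons)
  qed
  then show ?case
    by (simp add: G_def xs)
qed

lemma U_central:
  assumes "u \<in> U" "a \<in> J" "b \<in> J" "x \<in> J"
  shows "x * (commutator a b * u) = commutator a b * u * x"
  using commutator_mult_jordans_central[OF assms(2-4)] assms(1)
  by (elim U_jordansE) (simp add: commutator_def[of x])

text \<open>A trace may be attached to either of two commutators: \<open>commutator a b * u\<close>
  is central, so in \<open>x * commutator a b * u\<close> the letter moves to the right end.\<close>

lemma jordan_shift:
  assumes "u \<in> U" "a \<in> J" "b \<in> J" "x \<in> J"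
  shows "jordan (commutator a b) x * u = commutator a b * jordan u x"
  using U_central[OF assms] by (simp add: jordan_def algebra_simps)

text \<open>The Pluecker relation with traces attached. As in
  \<open>commutator_mult_jordans_central\<close>, substituting \<open>jordan j y\<close> for
  \<open>j\<close> shows that the sum is skew in \<open>j\<close> and \<open>y\<close>; here
  \<open>jordan_shift\<close> gathers all traces on the right factor. Two list elements again give
  symmetry against skewness, and a single one is computed directly.\<close>

lemma commutator_jordans_sum:
  assumes "l \<in> J" "k \<in> J" "i \<in> J" "j \<in> J" "set xs \<subseteq> J"
  shows "commutator l k * jordans (commutator i j) xs + commutator i k * jordans (commutator j l) xs
    + commutator j k * jordans (commutator l i) xs = 0"
  using assms
proof (induction "length xs" arbitrary: xs l k i j)
  case 0
  then show ?case
    using commutator_product_sum[of i j l k] U_mult_commutator[OF U.commutator]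
    by (simp add: add.assoc add.commute add.left_commute)
next
  case (Suc n xs l k i j)
  obtain y ys where xs: "xs = y # ys" "length ys = n"
    using Suc.hyps(2) by (cases xs) auto
  note J = Suc.prems(1-4)
  have y: "y \<in> J" and ys: "set ys \<subseteq> J"
    using Suc.prems xs by auto
  define P where "P l k i j y ys = commutator l k * jordans (commutator i j) (y # ys)
    + commutator i k * jordans (commutator j l) (y # ys)
    + commutator j k * jordans (commutator l i) (y # ys)" for l k i j y :: 'r and ys
  have skew: "P l k i j y ys = - P l k i y j ys"
    if "l \<in> J" "k \<in> J" "i \<in> J" "j \<in> J" "y \<in> J" "set ys \<subseteq> J" "length ys = n"
    for l k i j y ys
  proof -
    have sh: "jordan (commutator a k) x * jordans (commutator l i) ys
        = commutator a k * jordans (commutator l i) (x # ys)" if "a \<in> J" "x \<in> J" for a x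
      using that \<open>l \<in> J\<close> \<open>i \<in> J\<close> \<open>k \<in> J\<close> \<open>set ys \<subseteq> J\<close>
      by (simp add: jordans_Cons U.commutator jordan_shift jordans_in_U del: jordans.simps)
    have "0 = commutator l k * jordans (commutator i (jordan j y)) ys
      + commutator i k * jordans (commutator (jordan j y) l) ys
      + commutator (jordan j y) k * jordans (commutator l i) ys"
      using Suc.hyps(1)[of ys l k i "jordan j y"] that by (simp add: J_jordan)
    also have "\<dots> = P l k i j y ys + P l k i y j ys"
      using that by (simp add: commutator_jordan_right commutator_jordan_left jordans_add
        distrib_left distrib_right sh P_def del: jordans.simps(2))
        (simp add: algebra_simps)
    finally show ?thesis by (simp add: eq_neg_iff_add_eq_0)
  qed
  have "P l k i j y ys = 0"
  proof (cases ys)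
    case Nil
    have cyc: "P i k j l y ys = P l k i j y ys" for l k i j y
      unfolding P_def by (simp only: add.assoc add.commute add.left_commute)
    define Q where "Q l k i j = commutator l k * commutator i j + commutator i k * commutator j l
      + commutator j k * commutator l i" for l k i j :: 'r
    have Q: "Q l k i j = 0" if "l \<in> J" "k \<in> J" "i \<in> J" "j \<in> J" for l k i j
      using that Suc.hyps(1)[of "[]" l k i j] xs by (simp add: Q_def Nil)
    define T where "T i j y = jordan (commutator i j) y + jordan (commutator j y) i
      + jordan (commutator y i) j" for i j y :: 'r
    have T: "T i j y = (commutator i j * y + commutator j y * i + commutator y i * j)
      + (commutator i j * y + commutator j y * i + commutator y i * j)" for i j y
      by (simp add: T_def commutator_def jordan_def algebra_simps)
    have "P l k i y j ys = - P l k i j y ys"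
      using skew[of l k i j y ys] J y ys xs by simp
    moreover have "P y k i j l ys = - P l k i j y ys"
    proof -
      have "P y k i j l ys = P i k j y l ys"
        by (rule cyc[symmetric])
      also have "\<dots> = - P i k j l y ys"
        using skew J y ys xs by blast
      also have "P i k j l y ys = P l k i j y ys"
        by (rule cyc)
      finally show ?thesis .
    qed
    moreover have "P l k y j i ys = - P l k i j y ys"
    proof -
      have "P l k y j i ys = P y k j l i ys"
        by (rule cyc[symmetric])
      also have "\<dots> = P j k l y i ys"
        by (rule cyc[symmetric])
      also have "\<dots> = - P j k l i y ys"
        using skew J y ys xs by blast
      also have "P j k l i y ys = P i k j l y ys"
        by (rule cyc)
      also have "\<dots> = P l k i j y ys"
        by (rule cyc)
      finally show ?thesis .
    qed
    \<comment> \<open>Cyclic symmetry in \<open>l\<close>, \<open>i\<close>, \<open>j\<close> and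
      skewness in \<open>j\<close>, \<open>y\<close> make \<open>P\<close> alternating in
      \<open>l\<close>, \<open>i\<close>, \<open>j\<close>, \<open>y\<close>. Hence four signed
      copies add up to four times \<open>P\<close>, while their expansion can be regrouped.\<close>
    ultimately have "P l k i j y ys + P l k i j y ys + (P l k i j y ys + P l k i j y ys)
      = P l k i j y ys - P y k i j l ys - P l k y j i ys - P l k i y j ys"
      by simp
    also have "\<dots> = commutator l k * T i j y + commutator i k * T j l y + commutator j k * T l i y
        - commutator y k * T i j l"
      unfolding P_def Nil T_def commutator_swap[of j i] commutator_swap[of y j]
        commutator_swap[of y i] commutator_swap[of l j] commutator_swap[of y l] commutator_swap[of l i]
      by (simp add: jordan_minus_left algebra_simps)
    \<comment> \<open>Collecting terms by their rightmost letter leaves relations \<open>Q\<close>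
      without traces.\<close>
    also have "\<dots> = (Q l k i j * y - Q y k i j * l - Q l k y j * i - Q l k i y * j)
      + (Q l k i j * y - Q y k i j * l - Q l k y j * i - Q l k i y * j)"
      unfolding T Q_def commutator_swap[of j i] commutator_swap[of y j]
        commutator_swap[of y i] commutator_swap[of l j] commutator_swap[of y l] commutator_swap[of l i]
      by (simp add: algebra_simps)
    also have "\<dots> = 0"
      using J y by (simp add: Q)
    finally show ?thesis
      by (intro double_eq_0[of "P l k i j y ys"] double_eq_0[of "P l k i j y ys + P l k i j y ys"])
  next
    case (Cons z zs)
    have zs: "z \<in> J" "set zs \<subseteq> J" "Suc (length zs) = n"
      using ys xs Cons by auto
    define H where "H j y z = P l k i j y (z # zs)" for j y z
    have sym: "H j y z = H j z y" if "y \<in> J" "z \<in> J" "j \<in> J" for y z j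
      using that J by (simp add: H_def P_def jordan_right_commute[of _ y z] U.commutator)
    have sk: "H j y z = - H y j z" if "y \<in> J" "z \<in> J" "j \<in> J" for y z j
      using skew[of l k i j y "z # zs"] that J zs by (simp add: H_def)
    note J' = J y zs(1)
    have "H j y z = - H y j z"
      using J' by (intro sk)
    also have "H y j z = H y z j"
      using J' by (intro sym)
    also have "H y z j = - H z y j"
      using J' by (intro sk)
    also have "H z y j = H z j y"
      using J' by (intro sym)
    also have "H z j y = - H j z y"
      using J' by (intro sk)
    also have "H j z y = H j y z"
      using J' by (intro sym)
    finally have "H j y z = - H j y z"
      by simp
    then have "H j y z = 0"
      by (rule eq_minus_self_eq_0)
    then show ?thesis
      by (simp add: H_def Cons)
  qed
  then show ?case
    by (simp add: P_def xs)
qed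

text \<open>Each further trace changes the Jacobi sum by twice the sum in
  \<open>commutator_jordans_sum\<close>, so the Jacobi identity survives.\<close>

lemma commutator_jordans_jacobi:
  assumes "l \<in> J" "i \<in> J" "j \<in> J" "set xs \<subseteq> J"
  shows "commutator l (jordans (commutator i j) xs) + commutator i (jordans (commutator j l) xs)
    + commutator j (jordans (commutator l i) xs) = 0"
  using assms(4)
proof (induction xs rule: rev_induct)
  case Nil
  show ?case
    by (simp add: commutator_def algebra_simps)
next
  case (snoc y ys)
  let ?u = "\<lambda>i j. jordans (commutator i j) ys"
  have y: "y \<in> J" and ys: "set ys \<subseteq> J"
    using snoc.prems by auto
  have "commutator l (jordan (?u i j) y) + commutator i (jordan (?u j l) y)
      + commutator j (jordan (?u l i) y)
    = jordan (commutator l (?u i j) + commutator i (?u j l) + commutator j (?u l i)) y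
      + (jordan (?u i j) (commutator l y) + jordan (?u j l) (commutator i y)
        + jordan (?u l i) (commutator j y))"
    by (simp add: commutator_def[of l] commutator_def[of i] commutator_def[of j] jordan_def algebra_simps)
  also have "jordan (?u a b) (commutator c y) = commutator c y * ?u a b + commutator c y * ?u a b"
    if "a \<in> J" "b \<in> J" "c \<in> J" for a b c
    using that ys y U_mult_commutator[of "?u a b" c y] by (simp add: jordan_def jordans_in_U U.commutator)
  then have "jordan (?u i j) (commutator l y) + jordan (?u j l) (commutator i y)
        + jordan (?u l i) (commutator j y)
    = (commutator l y * ?u i j + commutator i y * ?u j l + commutator j y * ?u l i)
      + (commutator l y * ?u i j + commutator i y * ?u j l + commutator j y * ?u l i)"
    using assms by (simp add: algebra_simps)
  also have "commutator l y * ?u i j + commutator i y * ?u j l + commutator j y * ?u l i = 0"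
    using assms ys y by (intro commutator_jordans_sum)
  finally show ?case
    using snoc.IH ys by (simp add: jordans_snoc) (simp add: jordan_def)
qed

text \<open>Three vectors of a plane satisfy Cramer's relation with their minors as coefficients.
  The left side is this relation for the letters; the right side collects their traces.
  Algebraically, \<open>2 * l * c\<close> is \<open>jordan c l + commutator l c\<close>, and the
  commutators cancel by the Jacobi identity.\<close>

lemma letter_exchange:
  assumes "l \<in> J" "i \<in> J" "j \<in> J" "set xs \<subseteq> J"
  defines "u \<equiv> \<lambda>i j. jordans (commutator i j) xs"
  shows "2 * (l * u i j + i * u j l + j * u l i) = jordan (u i j) l + jordan (u j l) i + jordan (u l i) j"
proof -
  have "2 * (l * a + i * b + j * c)
      = jordan a l + jordan b i + jordan c j + (commutator l a + commutator i b + commutator j c)"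
    for a b c
    by (simp add: commutator_def jordan_def mult_2 algebra_simps)
  then show ?thesis
    using commutator_jordans_jacobi[OF assms(1-4)] by (simp add: u_def)
qed

text \<open>Reversals of triples preserve the parity of a place, so some letters can only reach the
  last place but one. For these the exchange has to pass over one letter \<open>k\<close>; the
  commutators with \<open>k\<close> cancel by \<open>commutator_jordans_sum\<close>.\<close>

lemma letter_exchange2:
  assumes "l \<in> J" "k \<in> J" "i \<in> J" "j \<in> J" "set xs \<subseteq> J"
  defines "u \<equiv> \<lambda>i j. jordans (commutator i j) xs"
  shows "2 * (l * (k * u i j) + i * (k * u j l) + j * (k * u l i))
    = k * (jordan (u i j) l + jordan (u j l) i + jordan (u l i) j)"
proof -
  have "2 * (l * (k * u i j) + i * (k * u j l) + j * (k * u l i))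
    = k * (2 * (l * u i j + i * u j l + j * u l i))
      + 2 * (commutator l k * u i j + commutator i k * u j l + commutator j k * u l i)"
    by (simp add: commutator_def mult_2 algebra_simps)
  also have "commutator l k * u i j + commutator i k * u j l + commutator j k * u l i = 0"
    unfolding u_def by (rule commutator_jordans_sum) fact+
  finally show ?thesis
    using letter_exchange[OF assms(1,3,4,5)] by (simp add: u_def)
qed

text \<open>Expanding the right side leaves letters to the right of central products such as
  \<open>commutator y z * u\<close>, from where they can be moved to the left. Every summand on the
  right has two letters and one trace instead of three letters, so up to shorter words this is
  \<open>x y z = z y x\<close>.\<close>

lemma triple_reverse_U:
  assumes "u \<in> U" "x \<in> J" "y \<in> J" "z \<in> J"
  shows "2 * (x * y * z * u - z * y * x * u)
    = commutator y z * jordan u x + commutator x z * jordan u y + commutator x y * jordan u z"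
proof -
  have c: "commutator a b * u * c = c * (commutator a b * u)" if "a \<in> J" "b \<in> J" "c \<in> J" for a b c
    using U_central[of u a b c] that assms by simp
  have "commutator y z * jordan u x + commutator x z * jordan u y + commutator x y * jordan u z
    = commutator y z * u * x + commutator x z * u * y + commutator x y * u * z
     + (commutator y z * x + commutator x z * y + commutator x y * z) * u"
    by (simp add: jordan_def algebra_simps)
  also have "\<dots> = 2 * (x * y * z * u - z * y * x * u)"
    unfolding c[OF assms(3,4,2)] c[OF assms(2,4,3)] c[OF assms(2,3,4)]
    by (simp add: commutator_def mult_2 algebra_simps)
  finally show ?thesis ..
qed

text \<open>Moving \<open>u\<close> to the left through \<open>w\<close> reduces this to the case of an empty word.\<close>

lemma triple_reverse:
  assumes "u \<in> U" "x \<in> J" "y \<in> J" "z \<in> J" "set w \<subseteq> J"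
  shows "2 * (x * y * z * (prod_list w * u) - z * y * x * (prod_list w * u))
    = commutator y z * (prod_list w * jordan u x) + commutator x z * (prod_list w * jordan u y)
      + commutator x y * (prod_list w * jordan u z)"
  using assms(1,5)
proof (induction w arbitrary: u rule: rev_induct)
  case Nil
  then show ?case
    using triple_reverse_U assms by simp
next
  case (snoc v w)
  have v: "v \<in> J" and w: "set w \<subseteq> J"
    using snoc.prems by auto
  define L where "L r = 2 * (x * y * z * r - z * y * x * r)" for r
  define M where "M a b c = commutator y z * (prod_list w * a) + commutator x z * (prod_list w * b)
      + commutator x y * (prod_list w * c)" for a b c
  have eq: "prod_list (w @ [v]) * u = prod_list w * jordan u v - prod_list w * u * v" for u
    by (simp add: jordan_def algebra_simps)
  have IH: "L (prod_list w * t) = M (jordan t x) (jordan t y) (jordan t z)" if "t \<in> U" for t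
    unfolding L_def M_def by (rule snoc.IH[OF that w])
  have "L (prod_list (w @ [v]) * u) = L (prod_list w * jordan u v) - L (prod_list w * u) * v"
    unfolding eq by (simp add: L_def algebra_simps)
  also have "\<dots> = M (jordan (jordan u v) x) (jordan (jordan u v) y) (jordan (jordan u v) z)
      - M (jordan u x) (jordan u y) (jordan u z) * v"
    by (simp only: IH[OF snoc.prems(1)] IH[OF U.jordan[OF snoc.prems(1) v]])
  also have "\<dots> = commutator y z * (prod_list (w @ [v]) * jordan u x)
      + commutator x z * (prod_list (w @ [v]) * jordan u y)
      + commutator x y * (prod_list (w @ [v]) * jordan u z)"
    unfolding eq jordan_right_commute[OF snoc.prems(1) v assms(2)]
      jordan_right_commute[OF snoc.prems(1) v assms(3)] jordan_right_commute[OF snoc.prems(1) v assms(4)]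
    by (simp add: M_def algebra_simps)
  finally show ?case
    unfolding L_def .
qed

end

section \<open>Finitely supported functions and scalars of the free algebra\<close>

lemma sum_singles:
  fixes f :: "'a \<Rightarrow>\<^sub>0 'b::comm_monoid_add"
  shows "(\<Sum>w\<in>Poly_Mapping.keys f. Poly_Mapping.single w (Poly_Mapping.lookup f w)) = f"
  by (rule poly_mapping_eqI)
    (auto simp: lookup_sum lookup_single when_def in_keys_iff)

lemma single_induct [case_names zero single add]:
  fixes f :: "'a \<Rightarrow>\<^sub>0 'b::comm_monoid_add"
  assumes "P 0" "\<And>w c. P (Poly_Mapping.single w c)" "\<And>f g. P f \<Longrightarrow> P g \<Longrightarrow> P (f + g)"
  shows "P f"
proof -
  have "P (\<Sum>w\<in>A. Poly_Mapping.single w (Poly_Mapping.lookup f w))" if "finite A" for A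
    using that by (induction A) (simp_all add: assms)
  from this[of "Poly_Mapping.keys f"] show ?thesis
    by (simp add: sum_singles)
qed

lemma sum_keys_extend:
  assumes "finite A" "Poly_Mapping.keys f \<subseteq> A" "\<And>w. \<phi> w 0 = 0"
  shows "(\<Sum>w\<in>Poly_Mapping.keys f. \<phi> w (Poly_Mapping.lookup f w)) = (\<Sum>w\<in>A. \<phi> w (Poly_Mapping.lookup f w))"
  using assms by (intro sum.mono_neutral_left) (auto simp: in_keys_iff)

lemma sum_keys_add:
  fixes \<phi> :: "'a \<Rightarrow> 'b::comm_monoid_add \<Rightarrow> 'c::comm_monoid_add"
  assumes "\<And>w. \<phi> w 0 = 0" "\<And>w a b. \<phi> w (a + b) = \<phi> w a + \<phi> w b"
  shows "(\<Sum>w\<in>Poly_Mapping.keys (f + g). \<phi> w (Poly_Mapping.lookup (f + g) w))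
    = (\<Sum>w\<in>Poly_Mapping.keys f. \<phi> w (Poly_Mapping.lookup f w))
      + (\<Sum>w\<in>Poly_Mapping.keys g. \<phi> w (Poly_Mapping.lookup g w))"
proof -
  let ?A = "Poly_Mapping.keys f \<union> Poly_Mapping.keys g"
  have "(\<Sum>w\<in>Poly_Mapping.keys h. \<phi> w (Poly_Mapping.lookup h w)) = (\<Sum>w\<in>?A. \<phi> w (Poly_Mapping.lookup h w))"
    if "Poly_Mapping.keys h \<subseteq> ?A" for h
    using that assms by (intro sum_keys_extend) auto
  from this[of f] this[of g] this[of "f + g"] show ?thesis
    using Poly_Mapping.keys_add[of f g] by (simp add: lookup_add assms sum.distrib)
qed

lemma scalar_mult_single: "scalar c * Poly_Mapping.single w d = Poly_Mapping.single w (c * d)"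
  by (simp add: scalar_def mult_single)

lemma scalar_central: "scalar c * f = f * scalar c"
  by (induction f rule: single_induct)
    (simp_all add: scalar_def mult_single mult.commute distrib_left distrib_right)

lemma scalar_add: "scalar (c + d) = scalar c + scalar d"
  by (simp add: scalar_def single_add)

lemma scalar_mult: "scalar (c * d) = scalar c * scalar d"
  by (simp add: scalar_def mult_single)

lemma scalar_0 [simp]: "scalar 0 = 0"
  by (simp add: scalar_def)

lemma scalar_1 [simp]: "scalar 1 = 1"
  by (simp add: scalar_def)

lemma scalar_uminus: "scalar (- c) = - scalar c"
  using scalar_add[of c "- c"] by (simp add: eq_neg_iff_add_eq_0 add.commute)

lemma scalar_of_nat: "scalar (of_nat n) = of_nat n"
  by (induction n) (simp_all add: scalar_add)

lemma single_eq_scalar_mult_word: "Poly_Mapping.single w c = scalar c * prod_list (map X (letters w))"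
proof -
  have "Poly_Mapping.single w 1 = (prod_list (map X (letters w)) :: 'a free_alg)" for w
  proof (cases w)
    case (Word xs)
    have "Poly_Mapping.single (Word xs) 1 = (prod_list (map X xs) :: 'a free_alg)"
    proof (induction xs)
      case (Cons x xs)
      have "Poly_Mapping.single (Word (x # xs)) 1 = (X x * Poly_Mapping.single (Word xs) 1 :: 'a free_alg)"
        by (simp add: X_def mult_single plus_free_monoid_def)
      with Cons show ?case by simp
    qed (simp flip: zero_free_monoid_def)
    then show ?thesis by (simp add: Word)
  qed
  then show ?thesis
    by (metis mult.right_neutral scalar_mult_single)
qed

section \<open>Substitution and evaluation\<close>

lemma subst_add: "subst u (f + g) = subst u f + subst u g"
  unfolding subst_def by (rule sum_keys_add) (simp_all add: scalar_add distrib_right)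

lemma subst_single: "subst u (Poly_Mapping.single w c) = scalar c * prod_list (map u (letters w))"
  by (simp add: subst_def)

lemma subst_mult: "subst u (f * g) = subst u f * subst u g"
proof (induction f rule: single_induct)
  case (single w c)
  show ?case
  proof (induction g rule: single_induct)
    case (single v d)
    have "prod_list (map u (letters w)) * (scalar d * r) = scalar d * (prod_list (map u (letters w)) * r)" for r
      by (metis mult.assoc scalar_central)
    then show ?case
      by (simp add: mult_single subst_single plus_free_monoid_def scalar_mult mult.assoc)
  qed (simp_all add: subst_add distrib_left, simp add: subst_def)
qed (simp_all add: subst_add distrib_right, simp add: subst_def)

lemma subst_0 [simp]: "subst u 0 = 0"
  by (simp add: subst_def)

lemma subst_uminus: "subst u (- f) = - subst u f"
  using subst_add[of u f "- f"] by (simp add: add_eq_0_iff)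

lemma subst_diff: "subst u (f - g) = subst u f - subst u g"
  using subst_add[of u f "- g"] by (simp add: subst_uminus)

lemma subst_X: "subst u (X i) = u i"
  by (simp add: X_def subst_single)

lemma subst_commutator: "subst u (commutator f g) = commutator (subst u f) (subst u g)"
  by (simp add: commutator_def subst_mult subst_diff)

lemma subst_jordan: "subst u (jordan f g) = jordan (subst u f) (subst u g)"
  by (simp add: jordan_def subst_mult subst_add)

definition word_eval :: "(nat \<Rightarrow> 'k::field^'n^'n) \<Rightarrow> nat list \<Rightarrow> 'k^'n^'n" where
  "word_eval g xs = foldr (\<lambda>i M. g i ** M) xs (mat 1)"

lemma word_eval_append: "word_eval g (xs @ ys) = word_eval g xs ** word_eval g ys"
  unfolding word_eval_def by (induction xs) (simp_all add: matrix_mul_assoc)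

lemma mat_mult_entry: "(mat c ** A) $ i $ j = c * A $ i $ j"
  by (simp add: matrix_matrix_mult_def mat_def if_distrib[of "\<lambda>x. x * _"] cong: if_cong)

lemma mat_mult_entry_right: "(A ** mat c) $ i $ j = A $ i $ j * c"
  by (simp add: matrix_matrix_mult_def mat_def if_distrib[of "\<lambda>x. _ * x"] cong: if_cong)

lemma matrix_mult_zero: "0 ** A = (0 :: 'k::field^'n^'n)" "A ** 0 = (0 :: 'k::field^'n^'n)"
  by (simp_all add: matrix_matrix_mult_def vec_eq_iff)

lemma matrix_mult_distrib_right: "(A + B) ** C = A ** C + B ** (C :: 'k::field^'n^'n)"
  by (simp add: matrix_matrix_mult_def vec_eq_iff distrib_right sum.distrib)

lemma mat_eval_add: "mat_eval g (f + h) = mat_eval g f + mat_eval g h"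
  unfolding mat_eval_def
  by (rule sum_keys_add) (simp_all add: vec_eq_iff mat_mult_entry distrib_right)

lemma mat_eval_single: "mat_eval g (Poly_Mapping.single w c) = mat c ** word_eval g (letters w)"
  by (simp add: mat_eval_def word_eval_def vec_eq_iff mat_mult_entry)

lemma mat_eval_0 [simp]: "mat_eval g 0 = 0"
  by (simp add: mat_eval_def)

lemma mat_eval_mult: "mat_eval g (f * h) = mat_eval g f ** mat_eval g h"
proof (induction f rule: single_induct)
  case (single w c)
  show ?case
  proof (induction h rule: single_induct)
    case (single v d)
    have "mat c ** A ** (mat d ** B) = mat (c * d) ** (A ** B)" for A B :: "'a^'b^'b"
    proof -
      have comm: "mat e ** A = A ** mat e" for e and A :: "'a^'b^'b"
        by (simp add: vec_eq_iff mat_mult_entry mat_mult_entry_right mult.commute)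
      have "mat c ** A ** (mat d ** B) = A ** (mat c ** mat d ** B)"
        by (simp add: comm[of c A] matrix_mul_assoc)
      also have "mat c ** mat d = (mat (c * d) :: 'a^'b^'b)"
        by (simp add: vec_eq_iff mat_mult_entry) (simp add: mat_def)
      also have "A ** (mat (c * d) ** B) = mat (c * d) ** (A ** B)"
        by (simp add: matrix_mul_assoc comm[of _ A])
      finally show ?thesis .
    qed
    then show ?case
      by (simp add: mult_single mat_eval_single plus_free_monoid_def word_eval_append)
  qed (simp_all add: mat_eval_add distrib_left matrix_add_ldistrib matrix_mult_zero)
qed (simp_all add: mat_eval_add distrib_right matrix_mult_distrib_right matrix_mult_zero)

lemma mat_eval_uminus: "mat_eval g (- f) = - mat_eval g f"
  using mat_eval_add[of g f "- f"] by (simp add: add_eq_0_iff)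

lemma mat_eval_diff: "mat_eval g (f - h) = mat_eval g f - mat_eval g h"
  using mat_eval_add[of g f "- h"] by (simp add: mat_eval_uminus)

lemma mat_eval_X: "mat_eval g (X i) = g i"
  by (simp add: X_def mat_eval_single word_eval_def)

lemma mat_eval_scalar: "mat_eval g (scalar c) = mat c"
  by (simp add: scalar_def mat_eval_single word_eval_def zero_free_monoid_def)

lemma mat_eval_1: "mat_eval g 1 = mat 1"
  using mat_eval_scalar[of g 1] by simp

section \<open>The identities hold for symmetric matrices\<close>

text \<open>The 24 terms are grouped by the three ways of splitting four letters into two pairs;
  each splitting contributes eight.\<close>

lemma standard_poly_4:
  "standard_poly 4 = (jordan (commutator (X 0) (X 1)) (commutator (X 2) (X 3))
    + jordan (commutator (X 1) (X 2)) (commutator (X 0) (X 3))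
    + jordan (commutator (X 2) (X 0)) (commutator (X 1) (X 3)) :: 'k::field free_alg)"
proof -
  have range: "{..<4} = {0, 1, 2, 3::nat}" "[0..<4] = [0, 1, 2, 3]"
    by (auto simp: upt_rec)
  have fin: "finite {1, 2, 3::nat}" "0 \<notin> {1, 2, 3::nat}" "finite {2, 3::nat}" "1 \<notin> {2, 3::nat}"
    "finite {3::nat}" "2 \<notin> {3::nat}"
    by auto
  have sums: "(\<Sum>x\<in>{0, 1, 2, 3::nat}. F x) = F 0 + F 1 + F 2 + F 3"
    "(\<Sum>x\<in>{1, 2, 3::nat}. F x) = F 1 + F 2 + F 3" "(\<Sum>x\<in>{2, 3::nat}. F x) = F 2 + F 3"
    "(\<Sum>x\<in>{3::nat}. F x) = F 3" "(\<Sum>x\<in>{id}. G x) = G id"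
    for F :: "nat \<Rightarrow> 'k free_alg" and G :: "(nat \<Rightarrow> nat) \<Rightarrow> 'k free_alg"
    by (simp_all add: add.assoc)
  have lists: "map g [0, 1, 2, 3] = [g 0, g 1, g 2, g 3]" "prod_list [a, b, c, d] = a * (b * (c * d))"
    for g :: "nat \<Rightarrow> 'k free_alg" and a b c d :: "'k free_alg"
    by simp_all
  have perm: "permutation (Transposition.transpose a b \<circ> q)"
    "sign (Transposition.transpose a b \<circ> q) = (if a = b then 1 else - 1) * sign q"
    if "permutation q" for a b :: nat and q
    using that by (simp_all add: permutation_compose sign_compose sign_swap_id permutation_swap_id)
  have neq: "(0::nat) \<noteq> 1" "(0::nat) \<noteq> 2" "(0::nat) \<noteq> 3" "(1::nat) \<noteq> 0" "(1::nat) \<noteq> 2" "(1::nat) \<noteq> 3"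
    "(2::nat) \<noteq> 0" "(2::nat) \<noteq> 1" "(2::nat) \<noteq> 3" "(3::nat) \<noteq> 0" "(3::nat) \<noteq> 1" "(3::nat) \<noteq> 2"
    by simp_all
  show ?thesis
    unfolding standard_poly_def range
    \<comment> \<open>Peeling off one point at a time writes each permutation as a product of
      transpositions, so that signs and values follow by rewriting.\<close>
    unfolding sum_over_permutations_insert[OF fin(1,2)] sum_over_permutations_insert[OF fin(3,4)]
      sum_over_permutations_insert[OF fin(5,6)] permutes_sing singleton_conv
    unfolding sums lists
    by (simp only: perm permutation_id sign_id o_apply id_apply Transposition.transpose_def if_True if_False
        neq refl mult_1 mult_1_right mult_minus_left mult_minus_right minus_minus of_int_1 of_int_minus)
      (simp add: commutator_def jordan_def algebra_simps)
qed

lemma mat_eval_SJ_symmetric: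
  assumes "f \<in> SJ" "\<And>i. g i \<in> symmetric_matrices"
  shows "mat_eval g f \<in> symmetric_matrices"
proof -
  have add: "A + B \<in> symmetric_matrices" if "A \<in> symmetric_matrices" "B \<in> symmetric_matrices" for A B :: "'a^'b^'b"
    using that by (simp add: symmetric_matrices_def transpose_def vec_eq_iff)
  show ?thesis
    using assms(1)
  proof induction
    case one
    then show ?case
      by (simp add: mat_eval_1 symmetric_matrices_def)
  next
    case (gen i)
    then show ?case
      by (simp add: mat_eval_X assms)
  next
    case (add f g)
    then show ?case
      by (simp add: mat_eval_add \<open>\<And>B A. _ \<Longrightarrow> _ \<Longrightarrow> A + B \<in> symmetric_matrices\<close>)
  next
    case (scale f c)
    then show ?case
      by (simp add: mat_eval_mult mat_eval_scalar symmetric_matrices_def transpose_def vec_eq_iff mat_mult_entry)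
  next
    case (jordan f h)
    then show ?case
      by (simp add: jordan_def mat_eval_add mat_eval_mult symmetric_matrices_def transpose_def vec_eq_iff
        matrix_matrix_mult_def mult.commute add.commute)
  qed
qed

lemma two_sided_ideal_weak_identities: "two_sided_ideal (weak_identities G)"
  by (simp add: two_sided_ideal_def weak_identities_def mat_eval_add mat_eval_mult matrix_mult_zero)

lemma subst_standard_poly_4:
  "subst u (standard_poly 4) = jordan (commutator (u 0) (u 1)) (commutator (u 2) (u 3))
    + jordan (commutator (u 1) (u 2)) (commutator (u 0) (u 3))
    + jordan (commutator (u 2) (u 0)) (commutator (u 1) (u 3))"
  by (simp add: standard_poly_4 subst_add subst_jordan subst_commutator subst_X)

lemma subst_metabelian_poly:
  "subst u metabelian_poly = commutator (commutator (u 0) (u 1)) (commutator (u 2) (u 3))"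
  by (simp add: metabelian_poly_def subst_commutator subst_X)

lemma weak_T_ideal_subset:
  "weak_T_ideal {standard_poly 4, metabelian_poly} \<subseteq>
     weak_identities (symmetric_matrices :: ('k::field^2^2) set)"
  unfolding weak_T_ideal_def
proof (intro hull_minimal two_sided_ideal_weak_identities subsetI, safe)
  fix u :: "nat \<Rightarrow> 'k free_alg"
  assume u: "\<forall>i. u i \<in> SJ"
  have "mat_eval g (subst u (standard_poly 4)) = 0 \<and> mat_eval g (subst u metabelian_poly) = 0"
    if g: "\<forall>i. g i \<in> symmetric_matrices" for g :: "nat \<Rightarrow> 'k^2^2"
  proof -
    have sym: "mat_eval g (u i) $ 2 $ 1 = mat_eval g (u i) $ 1 $ 2" for i
      using mat_eval_SJ_symmetric[of "u i" g] u g
      by (simp add: symmetric_matrices_def transpose_def vec_eq_iff)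
    define a b where "a i = mat_eval g (u i) $ 1 $ 1 - mat_eval g (u i) $ 2 $ 2"
      and "b i = mat_eval g (u i) $ 1 $ 2" for i
    \<comment> \<open>The commutator of two symmetric matrices is this minor times a fixed skew
      matrix. So commutators commute, and the standard polynomial becomes the Pluecker relation
      \<open>pl\<close>.\<close>
    define d where "d i j = a i * b j - a j * b i" for i j
    have d: "mat_eval g (commutator (u i) (u j))
        = (\<chi> r c. if r = c then 0 else if r = 1 then d i j else - d i j)" for i j
      by (simp add: mat_eval_diff mat_eval_mult commutator_def vec_eq_iff forall_2
          matrix_matrix_mult_def sum_2 sym a_def b_def d_def) (simp add: algebra_simps)
    have pl: "d i j * d k l + d j k * d i l + d k i * d j l = 0" for i j k l
      by (simp add: d_def algebra_simps)
    have "d 0 1 * d 2 3 + d 0 1 * d 2 3 + (d 1 2 * d 0 3 + d 1 2 * d 0 3) + (d 2 0 * d 1 3 + d 2 0 * d 1 3)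
      = (d 0 1 * d 2 3 + d 1 2 * d 0 3 + d 2 0 * d 1 3) + (d 0 1 * d 2 3 + d 1 2 * d 0 3 + d 2 0 * d 1 3)"
      by (simp only: add.assoc add.commute add.left_commute)
    then have pl2: "d 0 1 * d 2 3 + d 0 1 * d 2 3 + (d 1 2 * d 0 3 + d 1 2 * d 0 3)
      + (d 2 0 * d 1 3 + d 2 0 * d 1 3) = 0"
      by (simp only: pl add_0_left)
    have "mat_eval g (jordan (commutator (u i) (u j)) (commutator (u k) (u l)))
        = mat (- (d i j * d k l + d i j * d k l))"
      "mat_eval g (commutator (commutator (u i) (u j)) (commutator (u k) (u l))) = 0" for i j k l
      by (simp_all add: jordan_def[of "commutator _ _"] commutator_def[of "commutator _ _"]
        mat_eval_add mat_eval_diff mat_eval_mult d vec_eq_iff forall_2 matrix_matrix_mult_def sum_2 mat_def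
        mult.commute)
    then show ?thesis
      using pl2 unfolding subst_standard_poly_4 subst_metabelian_poly
      by (simp add: mat_eval_add vec_eq_iff mat_def algebra_simps neg_eq_iff_add_eq_0)
  qed
  then show "subst u (standard_poly 4) \<in> weak_identities (symmetric_matrices :: ('k^2^2) set)"
    "subst u metabelian_poly \<in> weak_identities (symmetric_matrices :: ('k^2^2) set)"
    by (simp_all add: weak_identities_def)
qed


section \<open>The quotient by the weak T-ideal\<close>

lemma two_sided_ideal_weak_T_ideal: "two_sided_ideal (weak_T_ideal F)"
  unfolding weak_T_ideal_def
proof (rule hull_in)
  fix T :: "'a free_alg set set"
  assume "Ball T two_sided_ideal"
  then show "two_sided_ideal (\<Inter> T)"
    unfolding two_sided_ideal_def by blast
qed

lemma weak_T_ideal_subst: "f \<in> F \<Longrightarrow> (\<And>i. u i \<in> SJ) \<Longrightarrow> subst u f \<in> weak_T_ideal F"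
  unfolding weak_T_ideal_def by (rule hull_inc) blast

abbreviation (input) symmetric_ideal :: "'k::field free_alg set" where
  "symmetric_ideal \<equiv> weak_T_ideal {standard_poly 4, metabelian_poly}"

lemma symmetric_ideal_simps:
  fixes f g h :: "'k::field free_alg"
  shows "0 \<in> (symmetric_ideal :: 'k free_alg set)"
    and "f \<in> symmetric_ideal \<Longrightarrow> g \<in> symmetric_ideal \<Longrightarrow> f + g \<in> symmetric_ideal"
    and "f \<in> symmetric_ideal \<Longrightarrow> h * f \<in> symmetric_ideal"
    and "f \<in> symmetric_ideal \<Longrightarrow> f * h \<in> symmetric_ideal"
    and "f \<in> symmetric_ideal \<Longrightarrow> - f \<in> symmetric_ideal"
    and "f \<in> symmetric_ideal \<Longrightarrow> g \<in> symmetric_ideal \<Longrightarrow> f - g \<in> symmetric_ideal"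
proof -
  let ?I = "symmetric_ideal :: 'k free_alg set"
  have I: "0 \<in> ?I" "\<forall>a\<in>?I. \<forall>b\<in>?I. a + b \<in> ?I" "\<forall>a\<in>?I. \<forall>r. r * a \<in> ?I \<and> a * r \<in> ?I"
    using two_sided_ideal_weak_T_ideal unfolding two_sided_ideal_def by blast+
  show "0 \<in> ?I" "f \<in> ?I \<Longrightarrow> g \<in> ?I \<Longrightarrow> f + g \<in> ?I"
    "f \<in> ?I \<Longrightarrow> h * f \<in> ?I" "f \<in> ?I \<Longrightarrow> f * h \<in> ?I"
    using I by blast+
  have "- a \<in> ?I" if "a \<in> ?I" for a
    using I(3) that by (metis mult_minus1)
  then show "f \<in> ?I \<Longrightarrow> - f \<in> ?I" "f \<in> ?I \<Longrightarrow> g \<in> ?I \<Longrightarrow> f - g \<in> ?I"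
    using I(2) by (blast, metis diff_conv_add_uminus)
qed

\<comment> \<open>The quotient becomes a type of its own, so that it can be a \<open>ring_1\<close>
  and the locale applies to it.\<close>
quotient_type (overloaded) 'k quotient_alg = "'k::field free_alg" /
  "\<lambda>f g. f - g \<in> symmetric_ideal"
proof (rule equivpI)
  show "reflp (\<lambda>f g. f - g \<in> (symmetric_ideal :: 'k free_alg set))"
    by (rule reflpI) (simp add: symmetric_ideal_simps)
  show "symp (\<lambda>f g. f - g \<in> (symmetric_ideal :: 'k free_alg set))"
    by (rule sympI) (metis minus_diff_eq symmetric_ideal_simps(5))
  show "transp (\<lambda>f g. f - g \<in> (symmetric_ideal :: 'k free_alg set))"
  proof (rule transpI)
    fix f g h :: "'k free_alg"
    assume "f - g \<in> symmetric_ideal" "g - h \<in> symmetric_ideal"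
    then show "f - h \<in> symmetric_ideal"
      using symmetric_ideal_simps(2)[of "f - g" "g - h"] by simp
  qed
qed

instantiation quotient_alg :: (field) ring_1
begin

lift_definition zero_quotient_alg :: "'a quotient_alg" is 0 .

lift_definition one_quotient_alg :: "'a quotient_alg" is 1 .

lift_definition plus_quotient_alg :: "'a quotient_alg \<Rightarrow> 'a quotient_alg \<Rightarrow> 'a quotient_alg" is "(+)"
proof -
  fix f g f' g' :: "'a free_alg"
  assume "f - g \<in> symmetric_ideal" "f' - g' \<in> symmetric_ideal"
  from symmetric_ideal_simps(2)[OF this] show "f + f' - (g + g') \<in> symmetric_ideal"
    by (simp add: algebra_simps)
qed

lift_definition uminus_quotient_alg :: "'a quotient_alg \<Rightarrow> 'a quotient_alg" is uminus
proof -
  fix f g :: "'a free_alg"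
  assume "f - g \<in> symmetric_ideal"
  from symmetric_ideal_simps(5)[OF this] show "- f - - g \<in> symmetric_ideal"
    by (simp add: algebra_simps)
qed

lift_definition minus_quotient_alg :: "'a quotient_alg \<Rightarrow> 'a quotient_alg \<Rightarrow> 'a quotient_alg" is "(-)"
proof -
  fix f g f' g' :: "'a free_alg"
  assume "f - g \<in> symmetric_ideal" "f' - g' \<in> symmetric_ideal"
  from symmetric_ideal_simps(6)[OF this] show "f - f' - (g - g') \<in> symmetric_ideal"
    by (simp add: algebra_simps)
qed

lift_definition times_quotient_alg :: "'a quotient_alg \<Rightarrow> 'a quotient_alg \<Rightarrow> 'a quotient_alg" is "(*)"
proof -
  fix f g f' g' :: "'a free_alg"
  assume *: "f - g \<in> symmetric_ideal" "f' - g' \<in> symmetric_ideal"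
  have "(f - g) * f' + g * (f' - g') \<in> symmetric_ideal"
    by (rule symmetric_ideal_simps(2)[OF symmetric_ideal_simps(4)[OF *(1)] symmetric_ideal_simps(3)[OF *(2)]])
  then show "f * f' - g * g' \<in> symmetric_ideal"
    by (simp add: algebra_simps)
qed

instance
proof
  fix a b c :: "'a quotient_alg"
  show "a + b + c = a + (b + c)" "a + b = b + a" "0 + a = a" "- a + a = 0" "a - b = a + - b"
    "a * b * c = a * (b * c)" "(a + b) * c = a * c + b * c" "a * (b + c) = a * b + a * c"
    "1 * a = a" "a * 1 = a"
    by (transfer; simp add: algebra_simps symmetric_ideal_simps)+
  \<comment> \<open>The inclusion already proved is what makes the quotient nonzero:
    \<open>1\<close> is no weak identity.\<close>
  show "(0 :: 'a quotient_alg) \<noteq> 1"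
  proof (transfer, rule notI)
    assume "(0 :: 'a free_alg) - 1 \<in> symmetric_ideal"
    then have "(0 :: 'a free_alg) - 1 \<in> weak_identities (symmetric_matrices :: ('a^2^2) set)"
      using weak_T_ideal_subset by blast
    then have "mat_eval (\<lambda>_. 0) (- 1 :: 'a free_alg) = (0 :: 'a^2^2)"
      by (simp add: weak_identities_def symmetric_matrices_def transpose_def vec_eq_iff)
    then have "(mat 1 :: 'a^2^2) $ 1 $ 1 = 0"
      by (simp add: mat_eval_uminus mat_eval_1)
    then show False
      by (simp add: mat_def)
  qed
qed

end

definition quot :: "'k::field free_alg \<Rightarrow> 'k quotient_alg" where
  "quot = abs_quotient_alg"

lemma quot_simps:
  "quot 0 = 0" "quot 1 = 1" "quot (f + g) = quot f + quot g" "quot (f - g) = quot f - quot g"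
  "quot (- f) = - quot f" "quot (f * g) = quot f * quot g"
  by (simp_all add: quot_def zero_quotient_alg.abs_eq one_quotient_alg.abs_eq plus_quotient_alg.abs_eq
    minus_quotient_alg.abs_eq uminus_quotient_alg.abs_eq times_quotient_alg.abs_eq)

lemma quot_eq_0_iff: "quot f = 0 \<longleftrightarrow> f \<in> symmetric_ideal"
  by (simp add: quot_def zero_quotient_alg.abs_eq quotient_alg.abs_eq_iff)

lemma quot_surj: "\<exists>f. r = quot f"
  by (induction r rule: quotient_alg.abs_induct) (auto simp: quot_def)

lemma quot_commutator: "quot (commutator f g) = commutator (quot f) (quot g)"
  by (simp add: commutator_def quot_simps)

lemma quot_jordan: "quot (jordan f g) = jordan (quot f) (quot g)"
  by (simp add: jordan_def quot_simps)

lemma SJ_diff: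
  assumes "f \<in> SJ" "g \<in> SJ"
  shows "f - g \<in> SJ"
proof -
  have "f + scalar (- 1) * g \<in> SJ"
    by (rule SJ.add[OF assms(1) SJ.scale[OF assms(2)]])
  then show ?thesis
    by (simp add: scalar_uminus)
qed

interpretation Q: jordan_pair "quot ` SJ :: 'k::field_char_0 quotient_alg set"
proof
  have quot_subst: "quot (subst u f) = 0" if "f \<in> {standard_poly 4, metabelian_poly}" "\<And>i. u i \<in> SJ"
    for u and f :: "'k free_alg"
    using that by (simp only: quot_eq_0_iff weak_T_ideal_subst)
  fix a b c d :: "'k quotient_alg"
  assume a: "a \<in> quot ` SJ" and b: "b \<in> quot ` SJ"
  show "a - b \<in> quot ` SJ"
    using a b by (auto simp flip: quot_simps intro: SJ_diff)
  show "jordan a b \<in> quot ` SJ"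
    using a b by (auto simp flip: quot_jordan intro: SJ.jordan)
  assume c: "c \<in> quot ` SJ" and d: "d \<in> quot ` SJ"
  obtain a' b' c' d' where abcd: "a = quot a'" "b = quot b'" "c = quot c'" "d = quot d'"
    "a' \<in> SJ" "b' \<in> SJ" "c' \<in> SJ" "d' \<in> SJ"
    using a b c d by blast
  \<comment> \<open>All variables must be sent into \<open>SJ\<close>, hence the index modulo
    4.\<close>
  define u where "u i = [a', b', c', d'] ! (i mod 4)" for i :: nat
  have "set [a', b', c', d'] \<subseteq> SJ"
    using abcd by simp
  then have "u i \<in> SJ" for i
    unfolding u_def by (rule subsetD) (rule nth_mem, simp)
  then have "quot (subst u (standard_poly 4)) = 0" "quot (subst u metabelian_poly) = 0"
    by (simp_all add: quot_subst)
  moreover have "u 0 = a'" "u 1 = b'" "u 2 = c'" "u 3 = d'"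
    by (simp_all add: u_def)
  ultimately show "commutator (commutator a b) (commutator c d) = 0"
    "jordan (commutator a b) (commutator c d) + jordan (commutator b c) (commutator a d)
        + jordan (commutator c a) (commutator b d) = 0"
    unfolding subst_standard_poly_4 subst_metabelian_poly
    by (simp_all only: quot_commutator quot_jordan quot_simps abcd)
next
  fix n :: nat and x :: "'k quotient_alg"
  assume n: "n > 0" and x: "of_nat n * x = 0"
  obtain f where f: "x = quot f"
    using quot_surj by blast
  have "quot (of_nat n) = (of_nat n :: 'k quotient_alg)"
    by (induction n) (simp_all add: quot_simps)
  with x f have "quot (of_nat n * f) = 0"
    by (simp add: quot_simps)
  then have "quot (scalar (1 / of_nat n) * (of_nat n * f)) = 0"
    by (simp add: quot_simps)
  moreover have "scalar (1 / of_nat n) * of_nat n = (1 :: 'k free_alg)"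
    using n by (simp flip: scalar_of_nat scalar_mult)
  then have "scalar (1 / of_nat n) * (of_nat n * f) = f"
    by (simp flip: mult.assoc)
  ultimately show "x = 0"
    by (simp add: f)
qed

section \<open>Evaluation at matrices with constant diagonal\<close>

definition mat22 :: "'a \<Rightarrow> 'a \<Rightarrow> 'a \<Rightarrow> 'a \<Rightarrow> 'a^2^2" where
  "mat22 a b c d = (\<chi> i j. if i = 1 then if j = 1 then a else b else if j = 1 then c else d)"

lemma mat22_simps [simp]:
  "mat22 a b c d $ 1 $ 1 = a" "mat22 a b c d $ 1 $ 2 = b" "mat22 a b c d $ 2 $ 1 = c" "mat22 a b c d $ 2 $ 2 = d"
  by (simp_all add: mat22_def)

text \<open>Conjugation by \<open>A\<close>, stated without an inverse.\<close>

lemma mat_eval_intertwine: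
  fixes A :: "'k::field^'n^'n"
  assumes "\<And>i. A ** g i = h i ** A"
  shows "A ** mat_eval g f = mat_eval h f ** A"
proof (induction f rule: single_induct)
  case (single w c)
  have "A ** word_eval g xs = word_eval h xs ** A" for xs
  proof (induction xs)
    case (Cons k xs)
    have "A ** word_eval g (k # xs) = h k ** (A ** word_eval g xs)"
      by (simp add: word_eval_def matrix_mul_assoc assms)
    also have "\<dots> = word_eval h (k # xs) ** A"
      unfolding Cons.IH by (simp add: word_eval_def matrix_mul_assoc)
    finally show ?case .
  qed (simp add: word_eval_def)
  moreover have "A ** mat c = mat c ** A"
    by (simp add: vec_eq_iff mat_mult_entry mat_mult_entry_right mult.commute)
  ultimately show ?case
    by (simp add: mat_eval_single matrix_mul_assoc) (simp flip: matrix_mul_assoc)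
qed (simp_all add: matrix_mult_zero mat_eval_add matrix_add_ldistrib matrix_mult_distrib_right)

lemma mat_eval_polynomial:
  assumes "\<And>k i j. \<exists>p. \<forall>x. g x k $ i $ j = poly p (x :: 'k::field)"
  shows "\<exists>p. \<forall>x. mat_eval (g x) f $ i $ j = poly p x"
proof (induction f arbitrary: i j rule: single_induct)
  case zero
  show ?case
    by (intro exI[of _ 0]) simp
next
  case (single w c)
  obtain P where P: "\<And>k i j x. g x k $ i $ j = poly (P k i j) x"
    using assms by metis
  have "\<exists>p. \<forall>x. word_eval (g x) xs $ i $ j = poly p x" for xs i j
  proof (induction xs arbitrary: i j)
    case Nil
    show ?case
      by (intro exI[of _ "if i = j then 1 else 0"]) (simp add: word_eval_def mat_def)
  next
    case (Cons k xs)
    obtain R where R: "\<And>i j x. word_eval (g x) xs $ i $ j = poly (R i j) x"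
      using Cons.IH by metis
    show ?case
      by (intro exI[of _ "\<Sum>l\<in>UNIV. P k i l * R l j"])
        (use R in \<open>simp add: word_eval_def matrix_matrix_mult_def P poly_sum\<close>)
  qed
  then obtain p where "\<forall>x. word_eval (g x) (letters w) $ i $ j = poly p x"
    by blast
  then show ?case
    by (intro exI[of _ "smult c p"]) (simp add: mat_eval_single mat_mult_entry)
next
  case (add f h)
  obtain p r where "\<forall>x. mat_eval (g x) f $ i $ j = poly p x" "\<forall>x. mat_eval (g x) h $ i $ j = poly r x"
    using add by metis
  then show ?case
    by (intro exI[of _ "p + r"]) (simp add: mat_eval_add)
qed

text \<open>
  For \<open>x = \<mu>^2 \<noteq> 0\<close> the matrices \<open>G x k\<close> below are conjugate to symmetric ones.  The
  entries of the value of \<open>f\<close> on them are polynomials in \<open>x\<close>, so \<open>x = - 1\<close> is allowed as well,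
  where the quadratic form splits over any field.
\<close>

lemma weak_identity_constant_diagonal:
  fixes t p q :: "nat \<Rightarrow> 'k::field_char_0"
  assumes f: "f \<in> weak_identities (symmetric_matrices :: ('k^2^2) set)"
  shows "mat_eval (\<lambda>k. mat22 (t k) (p k) (q k) (t k)) f = 0"
proof -
  define a b where "a k = (p k + q k) / 2" and "b k = (p k - q k) / 2" for k
  \<comment> \<open>For x = \<mu>^2 this is the conjugate by \<open>A\<close> of the symmetric
    matrix \<open>H k\<close> below. Only \<mu>^2 enters, and at x = -1 the entries become
    \<open>t k\<close>, \<open>p k\<close>, \<open>q k\<close>, \<open>t k\<close>.\<close>
  define G where "G x k = mat22 (t k + b k * (1 + x) / 2) (a k + b k * (1 - x) / 2)
    (a k - b k * (1 - x) / 2) (t k - b k * (1 + x) / 2)" for x k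
  have square: "mat_eval (G (\<mu>^2)) f = 0" if "\<mu> \<noteq> 0" for \<mu>
  proof -
    define A where "A = mat22 1 1 \<mu> (- \<mu>)"
    define H where "H k = mat22 (t k + a k) (\<mu> * b k) (\<mu> * b k) (t k - a k)" for k
    have "A ** G (\<mu>^2) k = H k ** A" for k
      by (simp add: A_def G_def H_def vec_eq_iff forall_2 matrix_matrix_mult_def sum_2 field_simps power2_eq_square)
    then have "A ** mat_eval (G (\<mu>^2)) f = mat_eval H f ** A"
      by (rule mat_eval_intertwine)
    also have "mat_eval H f = 0"
      using f by (simp add: weak_identities_def symmetric_matrices_def H_def transpose_def vec_eq_iff forall_2)
    finally have "A ** mat_eval (G (\<mu>^2)) f = 0"
      by (simp add: matrix_mult_zero)
    moreover define M where "M = mat_eval (G (\<mu>^2)) f"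
    ultimately have *: "M $ 1 $ j + M $ 2 $ j = 0" "\<mu> * (M $ 1 $ j - M $ 2 $ j) = 0" for j
      by (auto simp: A_def vec_eq_iff forall_2[of "\<lambda>i. \<forall>j. _ i j"] matrix_matrix_mult_def sum_2 algebra_simps)
    have "M $ 1 $ j = 0 \<and> M $ 2 $ j = 0" for j
    proof -
      have eq: "M $ 1 $ j = M $ 2 $ j"
        using *(2)[of j] \<open>\<mu> \<noteq> 0\<close> by simp
      then have "2 * M $ 2 $ j = 0"
        using *(1)[of j] by simp
      then show ?thesis
        using eq by simp
    qed
    then show ?thesis
      unfolding M_def[symmetric] by (simp add: vec_eq_iff forall_2)
  qed
  have "mat_eval (G (- 1)) f $ i $ j = 0" for i j
  proof -
    have "\<exists>r. \<forall>x. G x k $ i $ j = poly r x" for k i j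
    proof -
      have "\<exists>r. \<forall>x. c + d * x = poly r x" for c d :: 'k
        by (intro exI[of _ "[:c, d:]"]) (simp add: mult.commute)
      moreover have "G x k $ 1 $ 1 = (t k + b k / 2) + b k / 2 * x"
        "G x k $ 1 $ 2 = (a k + b k / 2) + - b k / 2 * x"
        "G x k $ 2 $ 1 = (a k - b k / 2) + b k / 2 * x"
        "G x k $ 2 $ 2 = (t k - b k / 2) + - b k / 2 * x" for x
        by (simp_all add: G_def field_simps)
      ultimately have "\<exists>r. \<forall>x. G x k $ 1 $ 1 = poly r x" "\<exists>r. \<forall>x. G x k $ 1 $ 2 = poly r x"
        "\<exists>r. \<forall>x. G x k $ 2 $ 1 = poly r x" "\<exists>r. \<forall>x. G x k $ 2 $ 2 = poly r x"
        by (simp_all only:)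
      then show ?thesis
        using exhaust_2[of i] exhaust_2[of j] by auto
    qed
    then obtain r where r: "\<And>x. mat_eval (G x) f $ i $ j = poly r x"
      using mat_eval_polynomial by metis
    have "infinite ((\<lambda>n. (of_nat (Suc n) :: 'k)^2) ` UNIV)"
    proof (rule range_inj_infinite, rule injI)
      fix m n
      assume "(of_nat (Suc m) :: 'k)^2 = of_nat (Suc n)^2"
      then have "of_nat ((Suc m)^2) = (of_nat ((Suc n)^2) :: 'k)"
        by simp
      then show "m = n"
        by (simp only: of_nat_eq_iff) (simp add: power2_eq_iff_nonneg del: of_nat_Suc power_Suc)
    qed
    moreover have "(\<lambda>n. (of_nat (Suc n) :: 'k)^2) ` UNIV \<subseteq> {x. poly r x = 0}"
    proof safe
      fix n
      have "(of_nat (Suc n) :: 'k) \<noteq> 0"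
        by (simp only: of_nat_eq_0_iff)
      from square[OF this] show "poly r ((of_nat (Suc n))^2) = 0"
        by (simp flip: r)
    qed
    ultimately have "r = 0"
      using poly_roots_finite[of r] finite_subset by blast
    then show ?thesis
      by (simp add: r)
  qed
  moreover have "G (- 1) = (\<lambda>k. mat22 (t k) (p k) (q k) (t k))"
    by (simp add: G_def a_def b_def fun_eq_iff field_simps)
  ultimately show ?thesis
    by (simp add: vec_eq_iff)
qed

text \<open>Evaluation of a chosen representative. Independence of the choice needs the ideal to
  vanish at \<open>g\<close>, which the next lemma obtains for constant diagonals.\<close>

definition mat_eval_quotient :: "(nat \<Rightarrow> 'k^'n^'n) \<Rightarrow> 'k::field quotient_alg \<Rightarrow> 'k^'n^'n" where
  "mat_eval_quotient g r = mat_eval g (rep_quotient_alg r)"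

lemma mat_eval_quotient_quot:
  fixes t p q :: "nat \<Rightarrow> 'k::field_char_0"
  defines "g \<equiv> \<lambda>k. mat22 (t k) (p k) (q k) (t k)"
  shows "mat_eval_quotient g (quot f) = mat_eval g f"
proof -
  have "quot (rep_quotient_alg (quot f) - f) = 0"
    unfolding quot_simps by (simp add: quot_def Quotient3_abs_rep[OF Quotient3_quotient_alg])
  then have "rep_quotient_alg (quot f) - f \<in> weak_identities (symmetric_matrices :: ('k^2^2) set)"
    using weak_T_ideal_subset by (auto simp: quot_eq_0_iff)
  then have "mat_eval g (rep_quotient_alg (quot f) - f) = 0"
    unfolding g_def by (rule weak_identity_constant_diagonal)
  then show ?thesis
    by (simp add: mat_eval_quotient_def mat_eval_diff)
qed

section \<open>Triangular families\<close>

context vector_space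
begin

text \<open>Indices may share a leading exponent; \<open>diff\<close> makes such members
  interchangeable up to lower ones. So at each level one member suffices, and comparing coefficients
  kills its multiple. The lemma serves twice: for words modulo the commutator ideal, and inside that
  ideal with \<open>S\<close> equal to zero.\<close>

lemma triangular_family:
  fixes e :: "'i \<Rightarrow> 'b" and lead :: "'i \<Rightarrow> nat" and ev :: "'b \<Rightarrow> 'c::{idom, ring_char_0} \<Rightarrow> 'c" and \<kappa> :: "'a \<Rightarrow> 'c"
  assumes S: "subspace S" and ev_S: "\<And>r x. r \<in> S \<Longrightarrow> ev r x = 0"
    and ev_add: "\<And>r r' x. ev (r + r') x = ev r x + ev r' x"
    and ev_scale: "\<And>c r x. ev (scale c r) x = \<kappa> c * ev r x"
    and \<kappa>: "\<And>c. \<kappa> c = 0 \<Longrightarrow> c = 0"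
    and lead: "\<And>i. i \<in> I \<Longrightarrow> \<exists>p. degree p \<le> lead i \<and> coeff p (lead i) \<noteq> 0 \<and> (\<forall>x. ev (e i) x = poly p x)"
    and diff: "\<And>i j. i \<in> I \<Longrightarrow> j \<in> I \<Longrightarrow> lead i = lead j \<Longrightarrow>
      e i - e j \<in> span (S \<union> e ` {k \<in> I. lead k < lead i})"
    and r: "r \<in> span (S \<union> e ` I)" "\<And>x. ev r x = 0"
  shows "r \<in> S"
proof -
  define L where "L n = span (S \<union> e ` {k \<in> I. lead k < n})" for n
  have poly_L: "\<exists>p. (\<forall>k\<ge>n. coeff p k = 0) \<and> (\<forall>x. ev r x = poly p x)" if "r \<in> L n" for n r
    using that unfolding L_def
  proof (induction rule: span_induct_alt)
    case base
    have "ev 0 x = 0" for x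
      using ev_S subspace_0[OF S] by blast
    then show ?case
      by (intro exI[of _ 0]) simp
  next
    case (step c y z)
    obtain p where p: "\<forall>k\<ge>n. coeff p k = 0" "\<forall>x. ev z x = poly p x"
      using step by blast
    have "\<exists>p. (\<forall>k\<ge>n. coeff p k = 0) \<and> (\<forall>x. ev y x = poly p x)"
    proof (cases "y \<in> S")
      case True
      then show ?thesis
        using ev_S by (intro exI[of _ 0]) simp
    next
      case False
      then obtain i where i: "y = e i" "i \<in> I" "lead i < n"
        using step by blast
      then show ?thesis
        using lead[OF i(2)] by (meson coeff_eq_0 le_less_trans less_le_trans)
    qed
    then obtain q where "\<forall>k\<ge>n. coeff q k = 0" "\<forall>x. ev y x = poly q x"
      by blast
    with p show ?case
      by (intro exI[of _ "smult (\<kappa> c) q + p"]) (simp add: ev_add ev_scale)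
  qed
  have main: "r \<in> S" if "r \<in> L n" "\<And>x. ev r x = 0" for n r
    using that
  proof (induction n arbitrary: r)
    case 0
    then show ?case
      using S by (simp add: L_def span_eq_iff[THEN iffD2])
  next
    case (Suc n)
    show ?case
    proof (cases "\<exists>i\<in>I. lead i = n")
      case False
      then have "{k \<in> I. lead k < Suc n} = {k \<in> I. lead k < n}"
        by (auto simp: less_Suc_eq)
      then show ?thesis
        using Suc by (simp add: L_def)
    next
      case True
      then obtain i where i: "i \<in> I" "lead i = n"
        by blast
      \<comment> \<open>Modulo \<open>L n\<close>, the span at level \<open>Suc n\<close> is at most
        one-dimensional, generated by \<open>e i\<close>.\<close>
      have "\<exists>c. r' - scale c (e i) \<in> L n" if "r' \<in> L (Suc n)" for r'
        using that unfolding L_def[of "Suc n"]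
      proof (induction rule: span_induct_alt)
        case base
        show ?case
          by (intro exI[of _ 0]) (simp add: L_def span_zero)
      next
        case (step c y z)
        have "\<exists>c. y - scale c (e i) \<in> L n"
        proof (cases "y \<in> S \<union> e ` {k \<in> I. lead k < n}")
          case True
          then show ?thesis
            by (intro exI[of _ 0]) (simp add: L_def span_base)
        next
          case False
          then obtain j where "y = e j" "j \<in> I" "lead j = n"
            using step by (auto simp: less_Suc_eq)
          then show ?thesis
            using diff[of j i] i by (intro exI[of _ 1]) (simp add: L_def)
        qed
        then obtain d where d: "y - scale d (e i) \<in> L n"
          by blast
        obtain d' where d': "z - scale d' (e i) \<in> L n"
          using step by blast
        have "scale c (y - scale d (e i)) + (z - scale d' (e i)) \<in> L n"
          using d d' unfolding L_def by (intro span_add span_scale)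
        then show ?case
          by (intro exI[of _ "c * d + d'"]) (simp add: algebra_simps)
      qed
      then obtain c where c: "r - scale c (e i) \<in> L n"
        using Suc.prems(1) by blast
      obtain p where p: "\<forall>k\<ge>n. coeff p k = 0" "\<And>x. ev (r - scale c (e i)) x = poly p x"
        using poly_L[OF c] by blast
      obtain q where q: "coeff q n \<noteq> 0" "\<And>x. ev (e i) x = poly q x"
        using lead[OF i(1)] i(2) by blast
      have "poly (smult (\<kappa> c) q + p) x = 0" for x
      proof -
        have "0 = ev (scale c (e i) + (r - scale c (e i))) x"
          using Suc.prems(2) by simp
        then show ?thesis
          by (simp only: ev_add ev_scale p q poly_add poly_smult)
      qed
      then have "smult (\<kappa> c) q + p = 0"
        by (intro poly_all_0_iff_0[THEN iffD1] allI)
      then have "coeff (smult (\<kappa> c) q + p) n = 0"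
        by (simp only: coeff_0)
      then have "c = 0"
        using q(1) p(1) \<kappa> by simp
      then show ?thesis
        using c Suc by simp
    qed
  qed
  have "\<exists>n. r \<in> L n"
    using r(1)
  proof (induction rule: span_induct_alt)
    case base
    show ?case
      by (simp add: L_def span_zero)
  next
    case (step c y z)
    have mono: "L m \<subseteq> L n" if "m \<le> n" for m n
      using that unfolding L_def by (intro span_mono) auto
    have "\<exists>n. y \<in> L n"
      using step unfolding L_def by (auto intro!: span_base)
    then obtain m n where "y \<in> L m" "z \<in> L n"
      using step by blast
    then have "y \<in> L (max m n)" "z \<in> L (max m n)"
      using mono[of m "max m n"] mono[of n "max m n"] by auto
    then have "scale c y + z \<in> L (max m n)"
      unfolding L_def by (intro span_add span_scale)
    then show ?case ..
  qed
  with main r(2) show ?thesis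
    by blast
qed

end

section \<open>Straightening\<close>

interpretation V: vector_space "\<lambda>c (r :: 'k::field quotient_alg). quot (scalar c) * r"
  by standard
    (simp_all add: distrib_left distrib_right scalar_add scalar_mult quot_simps mult.assoc)

definition letter :: "nat \<Rightarrow> 'k::field quotient_alg" where
  "letter i = quot (X i)"

definition word :: "nat list \<Rightarrow> 'k::field quotient_alg" where
  "word w = prod_list (map letter w)"

text \<open>The letters in \<open>as\<close> act as traces, those in \<open>w\<close> by left
  multiplication.\<close>

definition spanner :: "nat list \<Rightarrow> nat list \<Rightarrow> nat \<Rightarrow> nat \<Rightarrow> 'k::field quotient_alg" where
  "spanner as w i j = word w * jordans (commutator (letter i) (letter j)) (map letter as)"

text \<open>The filtration by word length. The bounds \<open>m\<close> on letters and
  \<open>d\<close> on the number of letters are carried along because the digit encoding of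
  exponents depends on them.\<close>

definition shorter :: "nat \<Rightarrow> nat \<Rightarrow> nat \<Rightarrow> 'k::field quotient_alg set" where
  "shorter m d n = V.span {spanner as w i j | as w i j.
     length w < n \<and> length as + length w \<le> d \<and> set as \<union> set w \<subseteq> {..<m} \<and> i < j \<and> j < m}"

lemma letter_in_J: "letter i \<in> quot ` SJ"
  by (simp add: letter_def SJ.gen)

lemma map_letter_in_J: "set (map letter as) \<subseteq> quot ` SJ"
  using letter_in_J by auto

lemma scalar_letter_commute: "quot (scalar c) * r = r * quot (scalar c)"
proof -
  obtain f where "r = quot f"
    using quot_surj by blast
  then show ?thesis
    by (simp flip: quot_simps add: scalar_central)
qed

lemma scalar_left_commute: "r * (quot (scalar c) * s) = quot (scalar c) * (r * s)"
  by (simp add: mult.assoc[symmetric] scalar_letter_commute[of c r])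

lemma word_simps [simp]: "word [] = 1" "word (k # w) = letter k * word w"
  by (simp_all add: word_def)

lemma word_append: "word (v @ w) = word v * word w"
  by (simp add: word_def)

lemma spanner_Cons: "spanner as (k # w) i j = letter k * spanner as w i j"
  by (simp add: spanner_def mult.assoc)

lemma spanner_append: "spanner as (v @ w) i j = word v * spanner as w i j"
  by (simp add: spanner_def word_append mult.assoc)

lemma spanner_swap: "spanner as w j i = - spanner as w i j"
proof -
  have "commutator (letter j) (letter i) = - commutator (letter i) (letter j :: 'a quotient_alg)"
    by (simp add: commutator_def)
  then show ?thesis
    by (simp add: spanner_def jordans_minus)
qed

lemma spanner_same: "spanner as w i i = 0"
  by (simp add: spanner_def commutator_def jordans_0)

lemma spanner_in_shorter:
  assumes "length w < n" "length as + length w \<le> d" "set as \<union> set w \<subseteq> {..<m}" "i < m" "j < m"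
  shows "spanner as w i j \<in> shorter m d n"
proof -
  have *: "spanner as w i j \<in> shorter m d n" if "i < j" "j < m" for i j
    unfolding shorter_def using assms(1-3) that by (intro V.span_base) blast
  show ?thesis
    using *[of i j] *[of j i] assms(4,5) V.span_neg
    by (cases i j rule: linorder_cases)
      (auto simp: spanner_same spanner_swap[of as w i j] shorter_def V.span_zero)
qed

lemma letter_mult_shorter:
  assumes "r \<in> shorter m d n" "k < m"
  shows "letter k * r \<in> shorter m (Suc d) (Suc n)"
  using assms(1) unfolding shorter_def[of m d n]
proof (induction rule: V.span_induct_alt)
  case base
  show ?case
    by (simp add: shorter_def V.span_zero)
next
  case (step c y z)
  have "letter k * y \<in> shorter m (Suc d) (Suc n)"
    using step(1) assms(2) by (auto simp: spanner_Cons[symmetric] subset_iff intro!: spanner_in_shorter)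
  moreover have "letter k * (quot (scalar c) * y + z) = quot (scalar c) * (letter k * y) + letter k * z"
    by (simp only: distrib_left scalar_left_commute)
  ultimately show ?case
    using step.IH unfolding shorter_def[of m "Suc d" "Suc n"]
    by (simp add: V.span_add V.span_scale)
qed

lemma word_mult_shorter:
  assumes "r \<in> shorter m d n" "set w \<subseteq> {..<m}"
  shows "word w * r \<in> shorter m (length w + d) (length w + n)"
  using assms(2) by (induction w) (simp_all add: assms(1) mult.assoc letter_mult_shorter)

lemma shorter_mono: "n \<le> n' \<Longrightarrow> d \<le> d' \<Longrightarrow> shorter m d n \<subseteq> shorter m d' n'"
  unfolding shorter_def
  by (intro V.span_mono Collect_mono) (blast intro: order.trans less_le_trans)

lemma shorter_diff: "r \<in> shorter m d n \<Longrightarrow> s \<in> shorter m d n \<Longrightarrow> r - s \<in> shorter m d n"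
  unfolding shorter_def by (rule V.span_diff)

lemma shorter_add: "r \<in> shorter m d n \<Longrightarrow> s \<in> shorter m d n \<Longrightarrow> r + s \<in> shorter m d n"
  unfolding shorter_def by (rule V.span_add)

lemma shorter_half:
  fixes r :: "'k::field_char_0 quotient_alg"
  assumes "2 * r \<in> shorter m d n"
  shows "r \<in> shorter m d n"
proof -
  have "scalar 2 = (1 + 1 :: 'k free_alg)"
    using scalar_of_nat[of 2, where 'a = 'k] by simp
  then have "quot (scalar 2) = (1 + 1 :: 'k quotient_alg)"
    by (simp only: quot_simps)
  then have two: "quot (scalar 2) = (2 :: 'k quotient_alg)"
    by simp
  have "quot (scalar (1 / 2)) * (quot (scalar 2) * r) = quot (scalar (1 / 2 * 2)) * r"
    by (rule V.scale_scale)
  then have "quot (scalar (1 / 2)) * (2 * r) = r"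
    by (simp add: two quot_simps)
  then show ?thesis
    using V.span_scale[of "2 * r" _ "1 / 2"] assms unfolding shorter_def by simp
qed

lemma spanner_snoc:
  "word w * jordan (jordans (commutator (letter i) (letter j)) (map letter as)) (letter k) = spanner (as @ [k]) w i j"
  by (simp add: spanner_def jordans_snoc)

text \<open>The correction terms of \<open>triple_reverse\<close> turn one letter into a trace: the
  word loses a letter while the total number of letters stays.\<close>

lemma spanner_reverse_triple:
  fixes m d :: nat
  defines "S \<equiv> shorter m d :: nat \<Rightarrow> 'k::field_char_0 quotient_alg set"
  assumes "length as + length (v @ [a, b, c] @ w) \<le> d" "set as \<union> set (v @ [a, b, c] @ w) \<subseteq> {..<m}" "i < m" "j < m"
  shows "spanner as (v @ [a, b, c] @ w) i j - spanner as (v @ [c, b, a] @ w) i j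
    \<in> S (length (v @ [a, b, c] @ w))"
proof -
  let ?u = "jordans (commutator (letter i) (letter j)) (map letter as) :: 'k quotient_alg"
  have u: "?u \<in> Q.U"
    by (intro Q.jordans_in_U Q.U.commutator letter_in_J map_letter_in_J)
  define r where "r = spanner as ([a, b, c] @ w) i j - (spanner as ([c, b, a] @ w) i j :: 'k quotient_alg)"
  let ?S = "shorter m (length as + length ([a, b, c] @ w)) (length ([a, b, c] @ w)) :: 'k quotient_alg set"
  have "2 * r = commutator (letter b) (letter c) * (word w * jordan ?u (letter a))
     + commutator (letter a) (letter c) * (word w * jordan ?u (letter b))
     + commutator (letter a) (letter b) * (word w * jordan ?u (letter c))"
    using Q.triple_reverse[OF u letter_in_J letter_in_J letter_in_J map_letter_in_J, of a b c w]
    by (simp add: r_def spanner_def word_def mult.assoc)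
  also have "commutator (letter x) (letter y) * (word w * jordan ?u (letter z))
      = spanner (as @ [z]) ([x, y] @ w) i j - spanner (as @ [z]) ([y, x] @ w) i j" for x y z
    by (simp add: spanner_Cons spanner_snoc[symmetric] commutator_def mult.assoc left_diff_distrib)
  then have "commutator (letter b) (letter c) * (word w * jordan ?u (letter a))
     + commutator (letter a) (letter c) * (word w * jordan ?u (letter b))
     + commutator (letter a) (letter b) * (word w * jordan ?u (letter c)) \<in> ?S"
    using assms by (auto intro!: shorter_add shorter_diff spanner_in_shorter)
  finally have "r \<in> ?S"
    by (rule shorter_half)
  then have "word v * r \<in> shorter m (length v + (length as + length ([a, b, c] @ w))) (length v + length ([a, b, c] @ w))"
    using assms(3) by (intro word_mult_shorter) auto
  also have "\<dots> \<subseteq> S (length (v @ [a, b, c] @ w))"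
    unfolding S_def using assms(2) by (intro shorter_mono) auto
  finally show ?thesis
    by (simp add: r_def spanner_append right_diff_distrib)
qed

text \<open>The cases of \<open>s\<close> are \<open>letter_exchange\<close> and
  \<open>letter_exchange2\<close>; the prefix \<open>v\<close> is attached by left
  multiplication.\<close>

lemma spanner_exchange:
  fixes m d :: nat
  defines "S \<equiv> shorter m d :: nat \<Rightarrow> 'k::field_char_0 quotient_alg set"
  assumes "length as + length (v @ [l] @ s) \<le> d" "set as \<union> set (v @ [l] @ s) \<subseteq> {..<m}" "i < m" "j < m"
    "length s \<le> 1"
  shows "spanner as (v @ [l] @ s) i j + spanner as (v @ [i] @ s) j l + spanner as (v @ [j] @ s) l i
    \<in> S (length (v @ [l] @ s))"
proof -
  define u where "u i j = (jordans (commutator (letter i) (letter j)) (map letter as) :: 'k quotient_alg)" for i j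
  define r where "r = spanner as ([l] @ s) i j + spanner as ([i] @ s) j l + (spanner as ([j] @ s) l i :: 'k quotient_alg)"
  let ?S = "shorter m (length as + length ([l] @ s)) (length ([l] @ s)) :: 'k quotient_alg set"
  have "2 * r = spanner (as @ [l]) s i j + spanner (as @ [i]) s j l + spanner (as @ [j]) s l i"
  proof (cases s)
    case Nil
    then show ?thesis
      using Q.letter_exchange[OF letter_in_J letter_in_J letter_in_J map_letter_in_J, of l i j as]
      by (simp add: r_def spanner_def jordans_snoc)
  next
    case (Cons k s')
    then have s: "s = [k]"
      using assms by simp
    show ?thesis
      using Q.letter_exchange2[OF letter_in_J letter_in_J letter_in_J letter_in_J map_letter_in_J, of l k i j as]
      by (simp add: r_def spanner_def jordans_snoc s distrib_left mult.assoc)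
  qed
  also have "\<dots> \<in> ?S"
    using assms by (auto intro!: shorter_add spanner_in_shorter)
  finally have "r \<in> ?S"
    by (rule shorter_half)
  then have "word v * r \<in> shorter m (length v + (length as + length ([l] @ s))) (length v + length ([l] @ s))"
    using assms(3) by (intro word_mult_shorter) auto
  also have "\<dots> \<subseteq> S (length (v @ [l] @ s))"
    unfolding S_def using assms(2) by (intro shorter_mono) auto
  finally show ?thesis
    by (simp add: r_def spanner_append distrib_left)
qed

text \<open>Places are counted from the left, starting with one. Along a row of the evaluated
  product, the odd places contribute one off-diagonal entry and the even places the other.\<close>

fun odds :: "'a list \<Rightarrow> 'a multiset" and evens :: "'a list \<Rightarrow> 'a multiset" where
  "odds [] = {#}"
| "odds (x # xs) = add_mset x (evens xs)"
| "evens [] = {#}"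
| "evens (x # xs) = odds xs"

lemma mset_odds_evens: "mset w = odds w + evens w"
  by (induction w) auto

lemma set_odds: "set_mset (odds w) \<subseteq> set w" and set_evens: "set_mset (evens w) \<subseteq> set w"
  using mset_odds_evens[of w] by (metis set_mset_mset set_mset_union Un_upper1, metis set_mset_mset set_mset_union Un_upper2)

lemma length_odds_evens: "length w = size (odds w) + size (evens w)"
  by (metis mset_odds_evens size_mset size_union)

section \<open>Moving letters within the odd and within the even places\<close>

lemma odds_to_front:
  assumes "k \<in># odds w"
  shows "\<exists>z. odds (k # z) = odds w \<and> evens (k # z) = evens w"
  using assms
proof (induction "length w" arbitrary: w rule: less_induct)
  case less
  obtain h y where w: "w = h # y"
    using less.prems by (cases w) auto
  show ?case
  proof (cases "k = h")
    case True
    then show ?thesis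
      by (intro exI[of _ y]) (simp add: w)
  next
    case False
    then have k: "k \<in># evens y"
      using less.prems w by simp
    then obtain l y' where y: "y = l # y'"
      by (cases y) auto
    obtain z where "odds (k # z) = odds y'" "evens (k # z) = evens y'"
      using less.hyps[of y'] k by (auto simp: w y)
    then show ?thesis
      by (intro exI[of _ "l # h # z"]) (auto simp: w y)
  qed
qed

text \<open>The quantifier over \<open>x\<close> is for the exchange, which puts another letter into
  the place of \<open>k\<close>. Parity decides whether \<open>s\<close> is empty or a single
  letter.\<close>

lemma odds_to_back:
  assumes "k \<in># odds w"
  shows "\<exists>v s P. odds w = add_mset k P \<and> length s \<le> 1 \<and>
    (\<forall>x. odds (v @ [x] @ s) = add_mset x P \<and> evens (v @ [x] @ s) = evens w)"
  using assms
proof (induction "length w" arbitrary: w rule: less_induct)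
  case less
  obtain a y where w: "w = a # y"
    using less.prems by (cases w) auto
  show ?case
  proof (cases "length y \<le> 1")
    case True
    then have "k = a"
      using less.prems by (cases y) (auto simp: w)
    then show ?thesis
      using True by (intro exI[of _ "[]"] exI[of _ y] exI[of _ "evens y"]) (simp add: w)
  next
    case False
    then obtain b c y' where y: "y = b # c # y'"
      by (cases y; cases "tl y") auto
    show ?thesis
    proof (cases "k \<in># odds (c # y')")
      case True
      then obtain v s P where "odds (c # y') = add_mset k P" "length s \<le> 1"
        "\<forall>x. odds (v @ [x] @ s) = add_mset x P \<and> evens (v @ [x] @ s) = evens (c # y')"
        using less.hyps[of "c # y'"] by (auto simp: w y)
      then show ?thesis
        by (intro exI[of _ "a # b # v"] exI[of _ s] exI[of _ "add_mset a P"])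
          (simp add: w y add_mset_commute)
    next
      case False
      then have "k \<in># odds (a # y')"
        using less.prems by (auto simp: w y)
      then obtain v s P where "odds (a # y') = add_mset k P" "length s \<le> 1"
        "\<forall>x. odds (v @ [x] @ s) = add_mset x P \<and> evens (v @ [x] @ s) = evens (a # y')"
        using less.hyps[of "a # y'"] by (auto simp: w y)
      then show ?thesis
        by (intro exI[of _ "c # b # v"] exI[of _ s] exI[of _ "add_mset c P"])
          (simp add: w y add_mset_commute[of a] add_mset_commute[of c])
    qed
  qed
qed

lemma evens_to_back:
  assumes "k \<in># evens w"
  shows "\<exists>v s P. evens w = add_mset k P \<and> length s \<le> 1 \<and>
    (\<forall>x. evens (v @ [x] @ s) = add_mset x P \<and> odds (v @ [x] @ s) = odds w)"
proof -
  obtain h y where w: "w = h # y" "k \<in># odds y"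
    using assms by (cases w) auto
  obtain v s P where "odds y = add_mset k P" "length s \<le> 1"
    "\<forall>x. odds (v @ [x] @ s) = add_mset x P \<and> evens (v @ [x] @ s) = evens y"
    using odds_to_back[OF w(2)] by blast
  then show ?thesis
    by (intro exI[of _ "h # v"] exI[of _ s] exI[of _ P]) (simp add: w)
qed

text \<open>Reversals of triples generate the permutations that keep parity of places. If the first
  letters differ, the first letter \<open>k'\<close> of \<open>w'\<close> is brought to the third
  place of \<open>w\<close> by induction, one reversal moves it to the front, and induction treats
  the rest.\<close>

lemma spanner_odds_evens:
  fixes as :: "nat list"
  assumes "odds w = odds w'" "evens w = evens w'"
    "length as + length w \<le> d" "set as \<union> set w \<subseteq> {..<m}" "i < m" "j < m"
  shows "spanner as w i j - spanner as w' i j \<in> (shorter m d (length w) :: 'k::field_char_0 quotient_alg set)"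
  using assms(1-4)
proof (induction "length w" arbitrary: w w' d)
  case 0
  then have "w = []" "w' = []"
    using length_odds_evens[of w'] by auto
  then show ?case
    by (simp add: shorter_def V.span_zero)
next
  case (Suc n w w' d)
  have "mset w' = mset w"
    using Suc.prems by (simp add: mset_odds_evens)
  then have len: "length w' = length w" and sets: "set w' = set w"
    by (auto dest: mset_eq_length mset_eq_setD)
  obtain k y where w: "w = k # y"
    using Suc.hyps by (cases w) auto
  obtain k' y' where w': "w' = k' # y'"
    using Suc.hyps len by (cases w') auto
  obtain e where e: "d = Suc e"
    using Suc.prems w by (cases d) auto
  have step: "spanner as (h # x) i j - spanner as (h # x') i j \<in> (shorter m d (length w) :: 'k quotient_alg set)"
    if "odds x = odds x'" "evens x = evens x'" "length x = n" "set (h # x) \<subseteq> set w" for h x x'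
  proof -
    have "spanner as x i j - spanner as x' i j \<in> (shorter m e (length x) :: 'k quotient_alg set)"
      using Suc.prems(3,4) that w e Suc.hyps(2) by (intro Suc.hyps(1)) auto
    moreover have "h < m"
      using that Suc.prems by auto
    ultimately have "letter h * (spanner as x i j - spanner as x' i j) \<in> (shorter m (Suc e) (Suc (length x)) :: 'k quotient_alg set)"
      by (rule letter_mult_shorter)
    then show ?thesis
      using that Suc.hyps(2) by (simp add: spanner_Cons e right_diff_distrib)
  qed
  show ?case
  proof (cases "k = k'")
    case True
    have "evens y = evens y'" "odds y = odds y'" "length y = n"
      using Suc.prems(1,2) Suc.hyps(2) True by (auto simp: w w')
    then have "spanner as (k # y) i j - spanner as (k # y') i j \<in> (shorter m d (length w) :: 'k quotient_alg set)"
      by (intro step) (auto simp: w)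
    then show ?thesis
      by (simp only: w w' True)
  next
    case False
    have "k' \<in># evens y"
      using Suc.prems(1) False by (auto simp: w w' add_eq_conv_ex)
    then obtain l y1 where y: "y = l # y1" "k' \<in># odds y1"
      by (cases y) auto
    obtain z where z: "odds (k' # z) = odds y1" "evens (k' # z) = evens y1"
      using odds_to_front[OF y(2)] by blast
    have mz: "mset (k' # z) = mset y1"
      unfolding mset_odds_evens z ..
    then have lz: "length (k' # z) = length y1" and sz: "set (k' # z) = set y1"
      by (metis size_mset, metis set_mset_mset)
    have "spanner as (k # y) i j - spanner as (k # l # k' # z) i j \<in> (shorter m d (length w) :: 'k quotient_alg set)"
      using z Suc.hyps(2) by (intro step) (auto simp: y w)
    then have 1: "spanner as w i j - spanner as (k # l # k' # z) i j \<in> (shorter m d (length w) :: 'k quotient_alg set)"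
      by (simp only: w)
    have 2: "spanner as ([] @ [k, l, k'] @ z) i j - spanner as ([] @ [k', l, k] @ z) i j
        \<in> (shorter m d (length ([] @ [k, l, k'] @ z)) :: 'k quotient_alg set)"
      using Suc.prems lz sz assms(5,6) by (intro spanner_reverse_triple) (auto simp: w y)
    have "add_mset k' (evens y') = add_mset k (odds y1)"
      using Suc.prems(1) by (simp add: y w w')
    also have "odds y1 = add_mset k' (evens z)"
      using z by simp
    finally have "evens (l # k # z) = evens y'"
      by (simp add: add_mset_commute[of k k'])
    moreover have "odds (l # k # z) = odds y'"
      using Suc.prems(2) z by (simp add: y w w')
    moreover have "length (l # k # z) = n" "set (k' # l # k # z) \<subseteq> set w"
      using lz sz Suc.hyps(2) by (auto simp: w y)
    ultimately have "spanner as (k' # l # k # z) i j - spanner as (k' # y') i j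
        \<in> (shorter m d (length w) :: 'k quotient_alg set)"
      by (intro step)
    then have 3: "spanner as (k' # l # k # z) i j - spanner as w' i j \<in> (shorter m d (length w) :: 'k quotient_alg set)"
      by (simp only: w')
    have "length ([] @ [k, l, k'] @ z) = length w"
      using lz by (simp add: w y)
    with 2 have "spanner as (k # l # k' # z) i j - spanner as (k' # l # k # z) i j
        \<in> (shorter m d (length w) :: 'k quotient_alg set)"
      by simp
    from shorter_add[OF shorter_add[OF 1 this] 3] show ?thesis
      by simp
  qed
qed

section \<open>Leading exponents\<close>

text \<open>A monomial as a number in base \<open>N\<close>: the digit at \<open>e\<close> is the
  multiplicity of \<open>e\<close>. There are no carries as long as the size stays below
  \<open>N\<close>.\<close>

definition digit_value :: "nat \<Rightarrow> nat multiset \<Rightarrow> nat" where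
  "digit_value N M = (\<Sum>e\<in>#M. N ^ e)"

lemma digit_value_simps [simp]:
  "digit_value N {#} = 0" "digit_value N (add_mset e M) = N ^ e + digit_value N M"
  "digit_value N (M + M') = digit_value N M + digit_value N M'"
  by (simp_all add: digit_value_def)

lemma digit_value_replicate [simp]: "digit_value N (replicate_mset n e) = n * N ^ e"
  by (induction n) simp_all

lemma digit_value_eq_sum:
  "set_mset M \<subseteq> {..<B} \<Longrightarrow> digit_value N M = (\<Sum>e<B. count M e * N ^ e)"
proof (induction M)
  case (add x M)
  have "(\<Sum>e<B. count (add_mset x M) e * N ^ e) = (\<Sum>e<B. (if e = x then N ^ e else 0) + count M e * N ^ e)"
    by (intro sum.cong) auto
  also have "\<dots> = N ^ x + (\<Sum>e<B. count M e * N ^ e)"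
    using add.prems by (simp add: sum.distrib)
  finally show ?case
    using add by simp
qed simp

lemma digits_unique:
  fixes f g :: "nat \<Rightarrow> nat"
  assumes "\<And>e. e < B \<Longrightarrow> f e < N" "\<And>e. e < B \<Longrightarrow> g e < N"
    "(\<Sum>e<B. f e * N ^ e) = (\<Sum>e<B. g e * N ^ e)" "e < B"
  shows "f e = g e"
  using assms
proof (induction B arbitrary: f g e)
  case (Suc B)
  define F where "F f = (\<Sum>e<B. f (Suc e) * N ^ e)" for f :: "nat \<Rightarrow> nat"
  have shift: "(\<Sum>e<Suc B. f e * N ^ e) = f 0 + N * F f" for f
    unfolding sum.lessThan_Suc_shift F_def by (simp add: sum_distrib_left mult_ac)
  have f0: "f 0 < N" and g0: "g 0 < N"
    using Suc.prems(1,2) by auto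
  have eq: "f 0 + N * F f = g 0 + N * F g"
    using Suc.prems(3) unfolding shift .
  then have "(f 0 + N * F f) mod N = (g 0 + N * F g) mod N" "(f 0 + N * F f) div N = (g 0 + N * F g) div N"
    by simp_all
  then have *: "f 0 = g 0" "F f = F g"
    using f0 g0 by simp_all
  show ?case
  proof (cases e)
    case (Suc e')
    have "(\<lambda>e. f (Suc e)) e' = (\<lambda>e. g (Suc e)) e'"
    proof (rule Suc.IH[of "\<lambda>e. f (Suc e)" "\<lambda>e. g (Suc e)"])
      show "(\<Sum>e<B. f (Suc e) * N ^ e) = (\<Sum>e<B. g (Suc e) * N ^ e)"
        using *(2) by (simp add: F_def)
    qed (use Suc Suc.prems in auto)
    then show ?thesis
      by (simp add: Suc)
  qed (simp add: *)
qed simp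

lemma digit_value_inject:
  assumes "size M < N" "size M' < N" "digit_value N M = digit_value N M'"
  shows "M = M'"
proof (rule multiset_eqI)
  fix x
  obtain B where "set_mset M \<union> set_mset M' \<union> {x} \<subseteq> {..<B}"
    using finite_nat_set_iff_bounded[of "set_mset M \<union> set_mset M' \<union> {x}"] by auto
  then show "count M x = count M' x"
    using assms digit_value_eq_sum[of M B N] digit_value_eq_sum[of M' B N]
    by (intro digits_unique[of B "count M" N "count M'"]) (auto intro: le_less_trans[OF count_le_size])
qed

lemma digit_value_less:
  assumes "set_mset M \<subseteq> {..<B}" "size M < N"
  shows "digit_value N M < N ^ B"
proof (cases B)
  case 0
  then show ?thesis
    using assms(1) by simp
next
  case (Suc b)
  have "digit_value N M \<le> size M * N ^ b"
    using assms(1)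
  proof (induction M)
    case (add x M)
    have "N ^ x \<le> N ^ b"
      using add.prems assms(2) Suc by (intro power_increasing) auto
    with add show ?case by simp
  qed simp
  also have "\<dots> < N * N ^ b"
    using assms(2) by simp
  finally show ?thesis
    by (simp add: Suc)
qed

lemma filter_mset_all: "(\<And>x. x \<in># M \<Longrightarrow> P x) \<Longrightarrow> filter_mset P M = M"
  by (induction M) auto

lemma filter_mset_none: "(\<And>x. x \<in># M \<Longrightarrow> \<not> P x) \<Longrightarrow> filter_mset P M = {#}"
  by (induction M) auto

text \<open>
  The exponent of the leading monomial when \<open>x\<^sub>k\<close> is evaluated at the matrix with entries
  \<open>t\<^sub>k, p\<^sub>k, q\<^sub>k, t\<^sub>k\<close>, where \<open>t\<^sub>k\<close>, \<open>p\<^sub>k\<close>, \<open>q\<^sub>k\<close> are the powers of one variable with exponents \<open>N^k\<close>,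
  \<open>N^(3m) + N^(m + k)\<close> and \<open>N^(3m) + N^(2m + k)\<close>.
\<close>

definition codes :: "nat \<Rightarrow> nat list \<Rightarrow> nat list \<Rightarrow> nat \<Rightarrow> nat \<Rightarrow> nat multiset" where
  "codes m as w i j = mset as + image_mset ((+) m) (add_mset i (odds w))
     + image_mset ((+) (2 * m)) (add_mset j (evens w))"

text \<open>The digit at \<open>3 * m\<close> counts off-diagonal factors: one for each letter of
  \<open>w\<close> and two from the commutator. Being the top digit, it orders spanning elements by
  word length first.\<close>

definition lead :: "nat \<Rightarrow> nat \<Rightarrow> nat list \<Rightarrow> nat list \<Rightarrow> nat \<Rightarrow> nat \<Rightarrow> nat" where
  "lead N m as w i j = digit_value N (codes m as w i j + replicate_mset (length w + 2) (3 * m))"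

definition indices :: "nat \<Rightarrow> nat \<Rightarrow> (nat list \<times> nat list \<times> nat \<times> nat) set" where
  "indices m d = {(as, w, i, j). length as + length w \<le> d \<and> set as \<union> set w \<subseteq> {..<m} \<and> i < j \<and> j < m}"

lemma set_codes:
  assumes "(as, w, i, j) \<in> indices m d"
  shows "set_mset (codes m as w i j) \<subseteq> {..<3 * m}"
  using assms set_odds[of w] set_evens[of w] by (fastforce simp: codes_def indices_def)

lemma size_codes:
  assumes "(as, w, i, j) \<in> indices m d"
  shows "size (codes m as w i j) \<le> d + 2"
  using assms length_odds_evens[of w] by (simp add: codes_def indices_def)

lemma lead_eq: "lead N m as w i j = digit_value N (codes m as w i j) + (length w + 2) * N ^ (3 * m)"
  by (simp add: lead_def)

lemma lead_less:
  assumes "(as, w, i, j) \<in> indices m d" "d + 2 < N" "length w < length w'"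
  shows "lead N m as w i j < lead N m as' w' i' j'"
proof -
  have "lead N m as w i j < N ^ (3 * m) + (length w + 2) * N ^ (3 * m)"
    unfolding lead_eq using assms
    by (intro add_strict_right_mono digit_value_less set_codes le_less_trans[OF size_codes])
  also have "\<dots> = (length w + 3) * N ^ (3 * m)"
    by (simp add: algebra_simps)
  also have "\<dots> \<le> (length w' + 2) * N ^ (3 * m)"
    using assms(3) by (intro mult_right_mono) auto
  finally show ?thesis
    by (simp add: lead_eq)
qed

lemma lead_inject:
  assumes x: "(as, w, i, j) \<in> indices m d" and y: "(as', w', i', j') \<in> indices m d"
    and N: "2 * d + 4 < N" and eq: "lead N m as w i j = lead N m as' w' i' j'"
  shows "mset as = mset as' \<and> add_mset i (odds w) = add_mset i' (odds w') \<and>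
    add_mset j (evens w) = add_mset j' (evens w')"
proof -
  \<comment> \<open>At most \<open>d + 2\<close> codes and at most \<open>d + 2\<close> copies of
    the top digit: this is the origin of the bound \<open>2 * d + 4\<close>.\<close>
  have size: "size (codes m as w i j + replicate_mset (length w + 2) (3 * m)) < N"
    if "(as, w, i, j) \<in> indices m d" for as w i j
    using that size_codes[OF that] N by (simp add: indices_def)
  have *: "codes m as w i j + replicate_mset (length w + 2) (3 * m)
      = codes m as' w' i' j' + replicate_mset (length w' + 2) (3 * m)"
    using size[OF x] size[OF y] eq unfolding lead_def by (rule digit_value_inject)
  have decode: "filter_mset (\<lambda>e. e < m) M = mset as"
    "image_mset (\<lambda>e. e - m) (filter_mset (\<lambda>e. m \<le> e \<and> e < 2 * m) M) = add_mset i (odds w)"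
    "image_mset (\<lambda>e. e - 2 * m) (filter_mset (\<lambda>e. 2 * m \<le> e \<and> e < 3 * m) M) = add_mset j (evens w)"
    if "(as, w, i, j) \<in> indices m d" "M = codes m as w i j + replicate_mset (length w + 2) (3 * m)"
    for as w i j M
  proof -
    have b: "x \<in> set as \<Longrightarrow> x < m" "x \<in># odds w \<Longrightarrow> x < m" "x \<in># evens w \<Longrightarrow> x < m" "i < m" "j < m" for x
      using that(1) set_odds[of w] set_evens[of w] by (auto simp: indices_def)
    have "filter_mset (\<lambda>e. e < m) M = mset as + {#} + {#} + {#}"
      unfolding that(2) codes_def filter_union_mset
      by (intro arg_cong2[where f = "(+)"] filter_mset_all filter_mset_none) (use b(4,5) in \<open>auto dest: b(1-3) split: if_splits\<close>)
    moreover have "filter_mset (\<lambda>e. m \<le> e \<and> e < 2 * m) M = {#} + image_mset ((+) m) (add_mset i (odds w)) + {#} + {#}"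
      unfolding that(2) codes_def filter_union_mset
      by (intro arg_cong2[where f = "(+)"] filter_mset_all filter_mset_none) (use b(4,5) in \<open>auto dest: b(1-3) split: if_splits\<close>)
    moreover have "filter_mset (\<lambda>e. 2 * m \<le> e \<and> e < 3 * m) M
        = {#} + {#} + image_mset ((+) (2 * m)) (add_mset j (evens w)) + {#}"
      unfolding that(2) codes_def filter_union_mset
      by (intro arg_cong2[where f = "(+)"] filter_mset_all filter_mset_none) (use b(4,5) in \<open>auto dest: b(1-3) split: if_splits\<close>)
    ultimately show "filter_mset (\<lambda>e. e < m) M = mset as"
      "image_mset (\<lambda>e. e - m) (filter_mset (\<lambda>e. m \<le> e \<and> e < 2 * m) M) = add_mset i (odds w)"
      "image_mset (\<lambda>e. e - 2 * m) (filter_mset (\<lambda>e. 2 * m \<le> e \<and> e < 3 * m) M) = add_mset j (evens w)"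
      by (simp_all add: multiset.map_comp comp_def)
  qed
  show ?thesis
    using decode[OF x refl] decode[OF y refl] unfolding * by simp
qed

text \<open>Exchanging a letter with \<open>i\<close> or \<open>j\<close> produces a second term in which \<open>p\<^sub>i q\<^sub>j\<close> is replaced by \<open>p\<^sub>j q\<^sub>i\<close>.\<close>

lemma pair_weight_less:
  fixes N :: nat
  assumes "i < j" "j < m" "2 \<le> N"
  shows "N ^ (m + j) + N ^ (2 * m + i) < N ^ (m + i) + N ^ (2 * m + j)"
proof -
  have "N * N ^ (m + j) \<le> N ^ (2 * m + j)" "N * N ^ (2 * m + i) \<le> N ^ (2 * m + j)"
    unfolding power_Suc[symmetric] using assms by (intro power_increasing; simp)+
  moreover have "2 * N ^ (m + j) \<le> N * N ^ (m + j)" "2 * N ^ (2 * m + i) \<le> N * N ^ (2 * m + i)"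
    using assms(3) by (intro mult_right_mono; simp)+
  moreover have "0 < N ^ (m + i)"
    using assms(3) by simp
  ultimately show ?thesis
    by linarith
qed

section \<open>The filtration by leading exponents\<close>

definition below :: "nat \<Rightarrow> nat \<Rightarrow> nat \<Rightarrow> nat \<Rightarrow> 'k::field quotient_alg set" where
  "below N m d n = V.span ((\<lambda>(as, w, i, j). spanner as w i j) `
     {(as, w, i, j) \<in> indices m d. lead N m as w i j < n})"

lemma below_add_diff:
  "r \<in> below N m d n \<Longrightarrow> s \<in> below N m d n \<Longrightarrow> t \<in> below N m d n \<Longrightarrow> r + s - t \<in> below N m d n"
  unfolding below_def by (intro V.span_add V.span_diff)

lemma below_add: "r \<in> below N m d n \<Longrightarrow> s \<in> below N m d n \<Longrightarrow> r + s \<in> below N m d n"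
  unfolding below_def by (rule V.span_add)

lemma spanner_in_below:
  "(as, w, i, j) \<in> indices m d \<Longrightarrow> lead N m as w i j < n \<Longrightarrow> spanner as w i j \<in> below N m d n"
  unfolding below_def by (rule V.span_base) force

lemma shorter_subset_below:
  assumes "length as + length w \<le> d" "d + 2 < N"
  shows "shorter m (length as + length w) (length w)
    \<subseteq> (below N m d (lead N m as' w i' j') :: 'k::field quotient_alg set)"
  unfolding shorter_def below_def
proof (rule V.span_mono, rule subsetI)
  fix r :: "'k quotient_alg"
  assume "r \<in> {spanner as1 w1 i1 j1 | as1 w1 i1 j1. length w1 < length w \<and>
    length as1 + length w1 \<le> length as + length w \<and> set as1 \<union> set w1 \<subseteq> {..<m} \<and> i1 < j1 \<and> j1 < m}"
  then obtain as1 w1 i1 j1 where r: "r = spanner as1 w1 i1 j1" and *: "length w1 < length w" "length as1 + length w1 \<le> length as + length w"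
    "set as1 \<union> set w1 \<subseteq> {..<m}" "i1 < j1" "j1 < m"
    by blast
  then have "(as1, w1, i1, j1) \<in> indices m d"
    using assms by (simp add: indices_def)
  moreover from this have "lead N m as1 w1 i1 j1 < lead N m as' w i' j'"
    using assms * by (intro lead_less)
  ultimately show "r \<in> (\<lambda>(as, w, i, j). spanner as w i j) `
     {(a, v, k, l) \<in> indices m d. lead N m a v k l < lead N m as' w i' j'}"
    unfolding r by force
qed

text \<open>The letter \<open>k\<close> changes places with \<open>i\<close>. Because
  \<open>k < i < j\<close>, both new commutators are again ordered; the one with \<open>k\<close>
  and \<open>j\<close> keeps the leading exponent, the other is lower by
  \<open>pair_weight_less\<close>.\<close>

lemma exchange_first:
  assumes x: "(as, w, i, j) \<in> indices m d" and N: "2 * d + 4 < N" and k: "k \<in># odds w" "k < i"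
  shows "\<exists>w'. (as, w', k, j) \<in> indices m d \<and> add_mset k (odds w') = add_mset i (odds w) \<and> evens w' = evens w \<and>
    spanner as w i j - spanner as w' k j \<in> (below N m d (lead N m as w i j) :: 'k::field_char_0 quotient_alg set)"
proof -
  obtain v s P where P: "odds w = add_mset k P" "length s \<le> 1"
    "\<And>y. odds (v @ [y] @ s) = add_mset y P" "\<And>y. evens (v @ [y] @ s) = evens w"
    using odds_to_back[OF k(1)] by blast
  have len: "length (v @ [y] @ s) = length w" for y
    unfolding length_odds_evens P by simp
  have "mset (v @ [k] @ s) = mset w"
    unfolding mset_odds_evens P ..
  then have "set (v @ [k] @ s) = set w"
    by (rule mset_eq_setD)
  then have sets: "set as \<union> set (v @ [y] @ s) \<subseteq> {..<m}" if "y < m" for y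
    using x that by (auto simp: indices_def)
  have b: "i < m" "j < m" "k < m" "i < j" "length as + length w \<le> d" "set as \<union> set w \<subseteq> {..<m}"
    using x k by (auto simp: indices_def)
  have idx: "(as, v @ [i] @ s, k, j) \<in> indices m d" "(as, v @ [j] @ s, k, i) \<in> indices m d"
    using sets b k len[of i] len[of j] by (simp_all add: indices_def)
  let ?S = "shorter m (length as + length w) (length w) :: 'k quotient_alg set"
  let ?B = "below N m d (lead N m as w i j) :: 'k quotient_alg set"
  have S: "?S \<subseteq> ?B"
    using b N by (intro shorter_subset_below) auto
  have "spanner as w i j - spanner as (v @ [k] @ s) i j \<in> ?S"
    using b P(1) P(3,4)[of k] by (intro spanner_odds_evens) auto
  moreover have "spanner as (v @ [k] @ s) i j + spanner as (v @ [i] @ s) j k + spanner as (v @ [j] @ s) k i \<in> ?S"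
    using spanner_exchange[of as v k s "length as + length w" m i j] sets b P(2) len[of k] by simp
  moreover have "lead N m as (v @ [j] @ s) k i < lead N m as w i j"
    using pair_weight_less[of i j m N] b N len[of j] P by (simp add: lead_eq codes_def del: append.simps)
  then have "spanner as (v @ [j] @ s) k i \<in> ?B"
    using idx by (intro spanner_in_below)
  ultimately have "(spanner as w i j - spanner as (v @ [k] @ s) i j)
      + (spanner as (v @ [k] @ s) i j + spanner as (v @ [i] @ s) j k + spanner as (v @ [j] @ s) k i)
      - spanner as (v @ [j] @ s) k i \<in> ?B"
    using S by (intro below_add_diff) (rule subsetD, assumption+)+
  moreover have "spanner as (v @ [i] @ s) j k = (- spanner as (v @ [i] @ s) k j :: 'k quotient_alg)"
    by (rule spanner_swap)
  ultimately have "spanner as w i j - spanner as (v @ [i] @ s) k j \<in> ?B"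
    by simp
  then show ?thesis
    using idx P by (intro exI[of _ "v @ [i] @ s"]) (simp add: add_mset_commute del: append.simps)
qed

lemma exchange_second:
  assumes x: "(as, w, i, j) \<in> indices m d" and N: "2 * d + 4 < N" and l: "l \<in># evens w" "j < l"
  shows "\<exists>w'. (as, w', i, l) \<in> indices m d \<and> odds w' = odds w \<and> add_mset l (evens w') = add_mset j (evens w) \<and>
    spanner as w i j - spanner as w' i l \<in> (below N m d (lead N m as w i j) :: 'k::field_char_0 quotient_alg set)"
proof -
  obtain v s P where P: "evens w = add_mset l P" "length s \<le> 1"
    "\<And>y. evens (v @ [y] @ s) = add_mset y P" "\<And>y. odds (v @ [y] @ s) = odds w"
    using evens_to_back[OF l(1)] by blast
  have len: "length (v @ [y] @ s) = length w" for y
    unfolding length_odds_evens P by simp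
  have "mset (v @ [l] @ s) = mset w"
    unfolding mset_odds_evens P ..
  then have set_w: "set (v @ [l] @ s) = set w"
    by (rule mset_eq_setD)
  then have sets: "set as \<union> set (v @ [y] @ s) \<subseteq> {..<m}" if "y < m" for y
    using x that by (auto simp: indices_def)
  have b: "i < m" "j < m" "l < m" "i < j" "length as + length w \<le> d" "set as \<union> set w \<subseteq> {..<m}"
    using x l set_evens[of w] by (auto simp: indices_def)
  have idx: "(as, v @ [j] @ s, i, l) \<in> indices m d" "(as, v @ [i] @ s, j, l) \<in> indices m d"
    using sets b l len[of i] len[of j] by (simp_all add: indices_def)
  let ?S = "shorter m (length as + length w) (length w) :: 'k quotient_alg set"
  let ?B = "below N m d (lead N m as w i j) :: 'k quotient_alg set"
  have S: "?S \<subseteq> ?B"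
    using b N by (intro shorter_subset_below) auto
  have "spanner as w i j - spanner as (v @ [l] @ s) i j \<in> ?S"
    using b P(1) P(3,4)[of l] by (intro spanner_odds_evens) auto
  moreover have "spanner as (v @ [l] @ s) i j + spanner as (v @ [i] @ s) j l + spanner as (v @ [j] @ s) l i \<in> ?S"
    using spanner_exchange[of as v l s "length as + length w" m i j] sets b P(2) len[of l] by simp
  moreover have "lead N m as (v @ [i] @ s) j l < lead N m as w i j"
    using pair_weight_less[of i j m N] b N len[of i] P by (simp add: lead_eq codes_def del: append.simps)
  then have "spanner as (v @ [i] @ s) j l \<in> ?B"
    using idx by (intro spanner_in_below)
  ultimately have "(spanner as w i j - spanner as (v @ [l] @ s) i j)
      + (spanner as (v @ [l] @ s) i j + spanner as (v @ [i] @ s) j l + spanner as (v @ [j] @ s) l i)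
      - spanner as (v @ [i] @ s) j l \<in> ?B"
    using S by (intro below_add_diff) (rule subsetD, assumption+)+
  moreover have "spanner as (v @ [j] @ s) l i = (- spanner as (v @ [j] @ s) i l :: 'k quotient_alg)"
    by (rule spanner_swap)
  ultimately have "spanner as w i j - spanner as (v @ [j] @ s) i l \<in> ?B"
    by simp
  then show ?thesis
    using idx P by (intro exI[of _ "v @ [j] @ s"]) (simp add: add_mset_commute del: append.simps)
qed

text \<open>The pair \<open>k\<close>, \<open>l\<close> depends only on the multisets that
  \<open>lead\<close> records, so elements with equal leading exponent arrive at the same
  commutator.\<close>

lemma spanner_canonical:
  assumes x: "(as, w, i, j) \<in> indices m d" and N: "2 * d + 4 < N"
  defines "k \<equiv> Min_mset (add_mset i (odds w))" and "l \<equiv> Max_mset (add_mset j (evens w))"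
  shows "\<exists>w'. (as, w', k, l) \<in> indices m d \<and> add_mset k (odds w') = add_mset i (odds w) \<and>
    add_mset l (evens w') = add_mset j (evens w) \<and>
    spanner as w i j - spanner as w' k l \<in> (below N m d (lead N m as w i j) :: 'k::field_char_0 quotient_alg set)"
proof -
  have kl: "k \<in># add_mset i (odds w)" "l \<in># add_mset j (evens w)" "k \<le> i" "j \<le> l"
    unfolding k_def l_def by (rule Min_in Max_in Min_le Max_ge; simp)+
  have "\<exists>w'. (as, w', k, j) \<in> indices m d \<and> add_mset k (odds w') = add_mset i (odds w) \<and> evens w' = evens w \<and>
    spanner as w i j - spanner as w' k j \<in> (below N m d (lead N m as w i j) :: 'k quotient_alg set)"
  proof (cases "k = i")
    case True
    then show ?thesis
      using x by (intro exI[of _ w]) (simp add: below_def V.span_zero)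
  next
    case False
    then show ?thesis
      using kl by (intro exchange_first x N) auto
  qed
  then obtain w1 where w1: "(as, w1, k, j) \<in> indices m d" "add_mset k (odds w1) = add_mset i (odds w)" "evens w1 = evens w"
    "spanner as w i j - spanner as w1 k j \<in> (below N m d (lead N m as w i j) :: 'k quotient_alg set)"
    by blast
  have "size (odds w1) = size (odds w)"
    using arg_cong[OF w1(2), of size] by simp
  then have "length w1 = length w"
    using w1 by (simp add: length_odds_evens)
  then have lead: "lead N m as w1 k j = lead N m as w i j"
    unfolding lead_eq codes_def w1 by simp
  have "\<exists>w'. (as, w', k, l) \<in> indices m d \<and> odds w' = odds w1 \<and> add_mset l (evens w') = add_mset j (evens w1) \<and>
    spanner as w1 k j - spanner as w' k l \<in> (below N m d (lead N m as w1 k j) :: 'k quotient_alg set)"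
  proof (cases "l = j")
    case True
    then show ?thesis
      using w1 by (intro exI[of _ w1]) (simp add: below_def V.span_zero)
  next
    case False
    then show ?thesis
      using kl w1 by (intro exchange_second w1 N) auto
  qed
  then obtain w2 where w2: "(as, w2, k, l) \<in> indices m d" "odds w2 = odds w1" "add_mset l (evens w2) = add_mset j (evens w1)"
    "spanner as w1 k j - spanner as w2 k l \<in> (below N m d (lead N m as w i j) :: 'k quotient_alg set)"
    unfolding lead by blast
  from below_add[OF w1(4) w2(4)] show ?thesis
    using w1 w2 by (intro exI[of _ w2]) simp
qed

lemma (in jordan_pair) jordans_perm:
  "mset xs = mset ys \<Longrightarrow> u \<in> U \<Longrightarrow> set xs \<subseteq> J \<Longrightarrow> jordans u xs = jordans u ys"
proof (induction xs arbitrary: ys u)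
  case (Cons x xs)
  have "x \<in> set ys"
    using Cons.prems(1) by (metis list.set_intros(1) mset_eq_setD)
  then obtain ys1 ys2 where ys: "ys = ys1 @ x # ys2"
    using split_list by metis
  have sets: "set ys \<subseteq> J"
    using Cons.prems by (metis mset_eq_setD)
  have app: "jordans v (as @ bs) = jordans (jordans v as) bs" for v as bs
    by (induction as arbitrary: v) simp_all
  have "jordans u ys = jordans (jordans u (x # ys1)) ys2"
    using jordans_Cons[of u ys1 x] Cons.prems sets by (simp add: ys app)
  also have "\<dots> = jordans (jordan u x) (ys1 @ ys2)"
    by (simp add: app)
  also have "\<dots> = jordans (jordan u x) xs"
    using Cons.prems by (intro Cons.IH[symmetric] U.jordan) (auto simp: ys)
  finally show ?case
    by simp
qed simp

text \<open>In canonical form both elements have the same commutator and, after cancelling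
  \<open>k\<close> and \<open>l\<close>, the same odd and even letters; the traces differ by a
  permutation.\<close>

lemma spanner_lead_eq:
  assumes x: "(as, w, i, j) \<in> indices m d" and y: "(as', w', i', j') \<in> indices m d"
    and N: "2 * d + 4 < N" and eq: "lead N m as w i j = lead N m as' w' i' j'"
  shows "spanner as w i j - spanner as' w' i' j' \<in> (below N m d (lead N m as w i j) :: 'k::field_char_0 quotient_alg set)"
proof -
  note inj = lead_inject[OF x y N eq]
  define k l where "k = Min_mset (add_mset i (odds w))" and "l = Max_mset (add_mset j (evens w))"
  let ?B = "below N m d (lead N m as w i j) :: 'k quotient_alg set"
  obtain w1 where w1: "(as, w1, k, l) \<in> indices m d" "add_mset k (odds w1) = add_mset i (odds w)"
    "add_mset l (evens w1) = add_mset j (evens w)" "spanner as w i j - spanner as w1 k l \<in> ?B"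
    using spanner_canonical[OF x N] unfolding k_def l_def by blast
  obtain w2 where w2: "(as', w2, k, l) \<in> indices m d" "add_mset k (odds w2) = add_mset i (odds w)"
    "add_mset l (evens w2) = add_mset j (evens w)" "spanner as' w' i' j' - spanner as' w2 k l \<in> ?B"
    using spanner_canonical[OF y N] inj unfolding k_def l_def eq by metis
  have cls: "odds w1 = odds w2" "evens w1 = evens w2"
    using w1 w2 by (metis add_mset_add_mset_same_iff)+
  have "spanner as' w2 k l = (spanner as w2 k l :: 'k quotient_alg)"
    using inj Q.jordans_perm[OF _ Q.U.commutator[OF letter_in_J letter_in_J] map_letter_in_J]
    unfolding spanner_def by (metis mset_map)
  moreover have "length w1 = length w"
    using arg_cong[OF w1(2), of size] arg_cong[OF w1(3), of size] by (simp add: length_odds_evens)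
  then have "lead N m as w1 k l = lead N m as w i j"
    unfolding lead_eq codes_def w1 by simp
  then have "spanner as w1 k l - spanner as w2 k l \<in> ?B"
    using spanner_odds_evens[OF cls, of as "length as + length w1" m k l] w1(1) N
      shorter_subset_below[of as w1 d N m as k l] by (auto simp: indices_def)
  ultimately have "(spanner as w i j - spanner as w1 k l) + (spanner as w1 k l - spanner as' w2 k l)
      - (spanner as' w' i' j' - spanner as' w2 k l) \<in> ?B"
    using w1(4) w2(4) by (simp only: below_add_diff)
  then show ?thesis
    by simp
qed

section \<open>Evaluation of the spanning elements\<close>

definition quotient_eval ::
  "(nat \<Rightarrow> 'k) \<Rightarrow> (nat \<Rightarrow> 'k) \<Rightarrow> (nat \<Rightarrow> 'k) \<Rightarrow> 'k::field_char_0 quotient_alg \<Rightarrow> 'k^2^2" where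
  "quotient_eval t p q = mat_eval_quotient (\<lambda>k. mat22 (t k) (p k) (q k) (t k))"

lemma quotient_eval_quot: "quotient_eval t p q (quot f) = mat_eval (\<lambda>k. mat22 (t k) (p k) (q k) (t k)) f"
  unfolding quotient_eval_def by (rule mat_eval_quotient_quot)

lemma quotient_eval_simps:
  "quotient_eval t p q (r + s) = quotient_eval t p q r + quotient_eval t p q s"
  "quotient_eval t p q (r - s) = quotient_eval t p q r - quotient_eval t p q s"
  "quotient_eval t p q (r * s) = quotient_eval t p q r ** quotient_eval t p q s"
proof -
  obtain f g where "r = quot f" "s = quot g"
    using quot_surj by metis
  then show "quotient_eval t p q (r + s) = quotient_eval t p q r + quotient_eval t p q s"
    "quotient_eval t p q (r - s) = quotient_eval t p q r - quotient_eval t p q s"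
    "quotient_eval t p q (r * s) = quotient_eval t p q r ** quotient_eval t p q s"
    by (simp_all add: quotient_eval_quot mat_eval_add mat_eval_diff mat_eval_mult flip: quot_simps)
qed

lemma quotient_eval_letter: "quotient_eval t p q (letter k) = mat22 (t k) (p k) (q k) (t k)"
  by (simp add: letter_def quotient_eval_quot mat_eval_X)

lemma quotient_eval_0: "quotient_eval t p q 0 = 0"
  using quotient_eval_quot[of t p q 0] by (simp add: quot_simps)

lemma quotient_eval_1: "quotient_eval t p q 1 = mat 1"
  using quotient_eval_quot[of t p q 1] by (simp add: quot_simps mat_eval_1)

lemma quotient_eval_scalar: "quotient_eval t p q (quot (scalar c) * r) $ i $ j = c * quotient_eval t p q r $ i $ j"
  by (simp add: quotient_eval_simps quotient_eval_quot mat_eval_scalar mat_mult_entry)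

text \<open>In split coordinates the fixed skew matrix becomes diagonal with entries 1 and -1, and
  the trace of a letter is \<open>2 * t a\<close>.\<close>

lemma quotient_eval_jordans:
  "quotient_eval t p q (jordans (commutator (letter i) (letter j)) (map letter as))
    = mat22 ((p i * q j - q i * p j) * (\<Prod>a\<leftarrow>as. 2 * t a)) 0 0 (- ((p i * q j - q i * p j) * (\<Prod>a\<leftarrow>as. 2 * t a)))"
proof (induction as rule: rev_induct)
  case Nil
  show ?case
    by (simp add: commutator_def quotient_eval_simps quotient_eval_letter vec_eq_iff forall_2
      matrix_matrix_mult_def sum_2 algebra_simps)
next
  case (snoc a as)
  show ?case
    unfolding map_append list.map jordans_snoc jordan_def quotient_eval_simps quotient_eval_letter snoc.IH
    by (simp add: vec_eq_iff forall_2 matrix_matrix_mult_def sum_2 algebra_simps)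
qed

text \<open>An entry of the matrix applied to the vector (1, 1). Parity of the word length decides
  whether the leading monomial is on or off the diagonal; the row sum catches it in both
  cases.\<close>

definition row_sum :: "'k::comm_monoid_add^2^2 \<Rightarrow> bool \<Rightarrow> 'k" where
  "row_sum M b = (if b then M $ 1 $ 1 + M $ 1 $ 2 else M $ 2 $ 1 + M $ 2 $ 2)"

lemma row_sum_letter:
  "row_sum (quotient_eval t p q (letter k * r)) b
    = t k * row_sum (quotient_eval t p q r) b + (if b then p k else q k) * row_sum (quotient_eval t p q r) (\<not> b)"
  by (simp add: row_sum_def quotient_eval_simps quotient_eval_letter matrix_matrix_mult_def sum_2 algebra_simps)

text \<open>The row sum of a word times the diagonal matrix with entries 1 and -1, hence the two
  base values. A letter either keeps the row with a factor \<open>t\<close> or changes it with a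
  factor \<open>p\<close> or \<open>q\<close>.\<close>

fun row_poly :: "nat \<Rightarrow> nat \<Rightarrow> bool \<Rightarrow> nat list \<Rightarrow> 'k::comm_ring_1 poly" where
  "row_poly N m b [] = (if b then 1 else - 1)"
| "row_poly N m b (k # w) = monom 1 (N ^ k) * row_poly N m b w
     + monom 1 (N ^ (3 * m) + N ^ ((if b then m else 2 * m) + k)) * row_poly N m (\<not> b) w"

definition row_lead :: "nat \<Rightarrow> nat \<Rightarrow> bool \<Rightarrow> nat list \<Rightarrow> nat" where
  "row_lead N m b w = digit_value N (image_mset ((+) (if b then m else 2 * m)) (odds w)
     + image_mset ((+) (if b then 2 * m else m)) (evens w)) + length w * N ^ (3 * m)"

lemma row_poly_lead:
  assumes "set w \<subseteq> {..<m}" "length w < N"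
  shows "degree (row_poly N m b w :: 'k::field poly) \<le> row_lead N m b w \<and>
    coeff (row_poly N m b w :: 'k::field poly) (row_lead N m b w) \<noteq> 0"
  using assms
proof (induction w arbitrary: b)
  case (Cons k w)
  let ?e = "N ^ (3 * m) + N ^ ((if b then m else 2 * m) + k)"
  have lead: "row_lead N m b (k # w) = ?e + row_lead N m (\<not> b) w"
    by (simp add: row_lead_def)
  have small: "x \<in># odds w \<Longrightarrow> x < m" "x \<in># evens w \<Longrightarrow> x < m" "k < m" for x
    using Cons.prems(1) set_odds[of w] set_evens[of w] by auto
  let ?M = "add_mset k (image_mset ((+) (if b then m else 2 * m)) (odds w)
     + image_mset ((+) (if b then 2 * m else m)) (evens w))"
  have "set_mset ?M \<subseteq> {..<3 * m}"
    using small(3) by (auto dest: small(1,2) split: if_splits)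
  moreover have "size ?M < N"
    using Cons.prems(2) by (simp add: length_odds_evens)
  ultimately have "digit_value N ?M < N ^ (3 * m)"
    by (rule digit_value_less)
  \<comment> \<open>Choosing the diagonal entry loses one top digit, and all remaining digits
    together are worth less than that.\<close>
  then have low: "N ^ k + row_lead N m b w < row_lead N m b (k # w)"
    unfolding lead by (simp add: row_lead_def)
  have IH: "degree (row_poly N m b w :: 'k poly) \<le> row_lead N m b w"
    "degree (row_poly N m (\<not> b) w :: 'k poly) \<le> row_lead N m (\<not> b) w"
    "coeff (row_poly N m (\<not> b) w :: 'k poly) (row_lead N m (\<not> b) w) \<noteq> 0"
    using Cons.IH Cons.prems by auto
  show ?case
  proof
    show "degree (row_poly N m b (k # w) :: 'k poly) \<le> row_lead N m b (k # w)"
    proof (rule degree_le, intro allI impI)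
      fix n
      assume n: "row_lead N m b (k # w) < n"
      then have "coeff (row_poly N m b w :: 'k poly) (n - N ^ k) = 0"
        using IH(1) low by (intro coeff_eq_0) linarith
      moreover have "coeff (row_poly N m (\<not> b) w :: 'k poly) (n - ?e) = 0"
        using IH(2) n lead by (intro coeff_eq_0) linarith
      ultimately show "coeff (row_poly N m b (k # w) :: 'k poly) n = 0"
        by (simp only: row_poly.simps coeff_add coeff_monom_mult) simp
    qed
    have "coeff (row_poly N m b w :: 'k poly) (row_lead N m b (k # w) - N ^ k) = 0"
      using IH(1) low by (intro coeff_eq_0) linarith
    moreover have "row_lead N m b (k # w) - ?e = row_lead N m (\<not> b) w" "\<not> row_lead N m b (k # w) < ?e"
      unfolding lead by auto
    ultimately show "coeff (row_poly N m b (k # w) :: 'k poly) (row_lead N m b (k # w)) \<noteq> 0"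
      using IH(3) by (simp only: row_poly.simps coeff_add coeff_monom_mult if_False) simp
  qed
qed (simp add: row_lead_def)

definition generic_row :: "nat \<Rightarrow> nat \<Rightarrow> 'k::field_char_0 quotient_alg \<Rightarrow> 'k \<Rightarrow> 'k" where
  "generic_row N m r x = row_sum (quotient_eval (\<lambda>k. x ^ (N ^ k)) (\<lambda>k. x ^ (N ^ (3 * m) + N ^ (m + k)))
     (\<lambda>k. x ^ (N ^ (3 * m) + N ^ (2 * m + k))) r) True"

lemma prod_list_powers: "(\<Prod>a\<leftarrow>as. c * x ^ (N ^ a)) = c ^ length as * (x :: 'k::field) ^ digit_value N (mset as)"
  by (induction as) (simp_all add: power_add)

lemma generic_row_spanner:
  assumes x: "(as, w, i, j) \<in> indices m d" and N: "2 * d + 4 < N"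
  shows "\<exists>P. degree P \<le> lead N m as w i j \<and> coeff P (lead N m as w i j) \<noteq> 0 \<and>
    (\<forall>x. generic_row N m (spanner as w i j :: 'k::field_char_0 quotient_alg) x = poly P x)"
proof -
  have b: "set w \<subseteq> {..<m}" "length w < N" "i < j" "j < m"
    using x N by (auto simp: indices_def)
  let ?Y = "row_poly N m True w :: 'k poly" and ?L = "row_lead N m True w"
  define A where "A = digit_value N (mset as) + 2 * N ^ (3 * m)"
  \<comment> \<open>The exponents come from the two terms of \<open>p i * q j - q i * p j\<close>;
    \<open>A\<close> holds the traces and the two top digits.\<close>
  define e1 e2 where "e1 = A + (N ^ (m + i) + N ^ (2 * m + j))" and "e2 = A + (N ^ (2 * m + i) + N ^ (m + j))"
  define P where "P = smult (2 ^ length as) (monom 1 e1 * ?Y - monom 1 e2 * ?Y)"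
  have lead: "lead N m as w i j = e1 + ?L"
    by (simp add: lead_eq codes_def row_lead_def e1_def A_def)
  have e: "e2 < e1"
    using pair_weight_less[of i j m N] b N by (simp add: e1_def e2_def)
  note Y = row_poly_lead[OF b(1,2), of True, where 'k = 'k]
  have zero: "coeff ?Y n = 0" if "?L < n" for n
    using Y that by (intro coeff_eq_0) auto
  have "coeff P n = 0" if "e1 + ?L < n" for n
    using that e by (simp add: P_def coeff_monom_mult zero)
  then have "degree P \<le> e1 + ?L"
    by (intro degree_le) simp
  moreover have "coeff P (e1 + ?L) = 2 ^ length as * coeff ?Y ?L"
    using e by (simp add: P_def coeff_monom_mult zero)
  moreover have "generic_row N m (spanner as w i j :: 'k quotient_alg) x = poly P x" for x
  proof -
    define t p q where "t = (\<lambda>k. x ^ (N ^ k))" and "p = (\<lambda>k. x ^ (N ^ (3 * m) + N ^ (m + k)))"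
      and "q = (\<lambda>k. x ^ (N ^ (3 * m) + N ^ (2 * m + k)))"
    define u where "u = (jordans (commutator (letter i) (letter j)) (map letter as) :: 'k quotient_alg)"
    have powers: "(x ^ (z + a) * x ^ (z + b) - x ^ (z + c) * x ^ (z + d)) * (y * x ^ v)
        = y * (x ^ (v + 2 * z + (a + b)) - x ^ (v + 2 * z + (c + d)))" for a b c d v z y
      unfolding mult_2 power_add by (simp add: algebra_simps)
    define D where "D = (p i * q j - q i * p j) * (\<Prod>a\<leftarrow>as. 2 * t a)"
    have "row_sum (quotient_eval t p q (word v * u)) b = poly (row_poly N m b v) x * D" for v b
    proof (induction v arbitrary: b)
      case Nil
      show ?case
        by (simp add: u_def quotient_eval_jordans row_sum_def D_def)
    next
      case (Cons k v)
      then show ?case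
        by (simp add: mult.assoc row_sum_letter poly_monom t_def p_def q_def)
          (simp add: algebra_simps power_add)
    qed
    then have "generic_row N m (spanner as w i j) x = poly ?Y x * D"
      by (simp add: generic_row_def spanner_def u_def t_def p_def q_def)
    also have "D = 2 ^ length as * (x ^ e1 - x ^ e2)"
      unfolding D_def t_def p_def q_def prod_list_powers e1_def e2_def A_def by (rule powers)
    finally show ?thesis
      by (simp add: P_def poly_monom algebra_simps)
  qed
  ultimately show ?thesis
    unfolding lead using Y by (intro exI[of _ P]) simp
qed

lemma generic_row_injective:
  fixes r :: "'k::field_char_0 quotient_alg"
  assumes "r \<in> V.span ((\<lambda>(as, w, i, j). spanner as w i j) ` indices m d)" "2 * d + 4 < N"
    "\<And>x. generic_row N m r x = 0"
  shows "r = 0"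
proof -
  let ?e = "\<lambda>(as, w, i, j). spanner as w i j :: 'k quotient_alg" and ?l = "\<lambda>(as, w, i, j). lead N m as w i j"
  have "r \<in> {0}"
  proof (rule V.triangular_family[where e = ?e and lead = ?l and I = "indices m d" and ev = "generic_row N m" and \<kappa> = id])
    show "generic_row N m r x = 0" if "r \<in> {0}" for r :: "'k quotient_alg" and x
      using that by (simp add: generic_row_def quotient_eval_0 row_sum_def)
    show "generic_row N m (r + r') x = generic_row N m r x + generic_row N m r' x" for r r' x
      by (simp add: generic_row_def quotient_eval_simps row_sum_def)
    show "generic_row N m (quot (scalar c) * r) x = id c * generic_row N m r x" for c r x
      by (simp add: generic_row_def quotient_eval_scalar row_sum_def distrib_left)
    show "\<exists>p. degree p \<le> ?l y \<and> coeff p (?l y) \<noteq> 0 \<and> (\<forall>x. generic_row N m (?e y) x = poly p x)"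
      if "y \<in> indices m d" for y
      using generic_row_spanner[OF _ assms(2)] that by (cases y) auto
    show "?e y - ?e z \<in> V.span ({0} \<union> ?e ` {k \<in> indices m d. ?l k < ?l y})"
      if "y \<in> indices m d" "z \<in> indices m d" "?l y = ?l z" for y z
    proof -
      have "?e y - ?e z \<in> below N m d (?l y)"
        using that spanner_lead_eq[OF _ _ assms(2)] by (cases y; cases z) auto
      also have "\<dots> \<subseteq> V.span ({0} \<union> ?e ` {k \<in> indices m d. ?l k < ?l y})"
        unfolding below_def by (intro V.span_mono) force
      finally show ?thesis .
    qed
    show "r \<in> V.span ({0} \<union> ?e ` indices m d)"
      using assms(1) V.span_mono[of "?e ` indices m d" "{0} \<union> ?e ` indices m d"] by blast
  qed (use assms in simp_all)
  then show ?thesis by simp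
qed

section \<open>The commutator ideal\<close>

text \<open>Only a span by definition; \<open>ideal_letter\<close> shows closure under
  multiplication by letters on both sides.\<close>

definition commutator_ideal :: "'k::field quotient_alg set" where
  "commutator_ideal = V.span {spanner as w i j | as w i j. True}"

lemma spanner_in_ideal: "spanner as w i j \<in> commutator_ideal"
  unfolding commutator_ideal_def by (intro V.span_base) blast

lemma ideal_add: "r \<in> commutator_ideal \<Longrightarrow> s \<in> commutator_ideal \<Longrightarrow> r + s \<in> commutator_ideal"
  unfolding commutator_ideal_def by (rule V.span_add)

lemma ideal_diff: "r \<in> commutator_ideal \<Longrightarrow> s \<in> commutator_ideal \<Longrightarrow> r - s \<in> commutator_ideal"
  unfolding commutator_ideal_def by (rule V.span_diff)

lemma ideal_letter:
  assumes "r \<in> commutator_ideal"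
  shows "letter k * r \<in> commutator_ideal" "r * letter k \<in> commutator_ideal"
proof -
  have "letter k * r \<in> commutator_ideal \<and> r * letter k \<in> commutator_ideal"
    using assms unfolding commutator_ideal_def[unfolded atomize_eq]
  proof (induction rule: V.span_induct_alt)
    case base
    show ?case
      by (simp add: V.span_zero)
  next
    case (step c y z)
    then obtain as w i j where y: "y = spanner as w i j"
      by blast
    \<comment> \<open>For \<open>u\<close> in \<open>U\<close>, right multiplication is
      \<open>u * x = jordan u x - x * u\<close>: a further trace minus a further letter of the
      word.\<close>
    have "y * letter k = spanner (as @ [k]) w i j - spanner as (w @ [k]) i j"
      by (simp add: y spanner_def jordans_snoc jordan_def word_append algebra_simps)
    then have "letter k * y \<in> commutator_ideal" "y * letter k \<in> commutator_ideal"
      unfolding y by (auto simp: spanner_Cons[symmetric] intro: ideal_diff spanner_in_ideal)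
    moreover have "letter k * (quot (scalar c) * y + z) = quot (scalar c) * (letter k * y) + letter k * z"
      "(quot (scalar c) * y + z) * letter k = quot (scalar c) * (y * letter k) + z * letter k"
      by (simp_all only: distrib_left distrib_right scalar_left_commute mult.assoc)
    ultimately show ?case
      using step.IH by (simp add: commutator_ideal_def V.span_add V.span_scale)
  qed
  then show "letter k * r \<in> commutator_ideal" "r * letter k \<in> commutator_ideal"
    by blast+
qed

lemma word_move_letter: "word (k # u @ v) - word (u @ k # v) \<in> (commutator_ideal :: 'k::field quotient_alg set)"
proof (induction u)
  case (Cons h u)
  have "spanner [] [] k h * word x \<in> (commutator_ideal :: 'k quotient_alg set)" for x
    by (induction x rule: rev_induct)
      (simp_all add: spanner_in_ideal word_append ideal_letter flip: mult.assoc)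
  then have "spanner [] [] k h * word (u @ v) + letter h * (word (k # u @ v) - word (u @ k # v))
      \<in> (commutator_ideal :: 'k quotient_alg set)"
    by (intro ideal_add ideal_letter Cons.IH)
  then show ?case
    by (simp add: spanner_def commutator_def algebra_simps)
qed (simp add: commutator_ideal_def V.span_zero)

lemma word_mset:
  "mset w = mset w' \<Longrightarrow> word w - word w' \<in> (commutator_ideal :: 'k::field quotient_alg set)"
proof (induction w arbitrary: w')
  case Nil
  then show ?case
    by (simp add: commutator_ideal_def V.span_zero)
next
  case (Cons k w)
  have "k \<in> set w'"
    using Cons.prems by (metis list.set_intros(1) mset_eq_setD)
  then obtain u v where w': "w' = u @ k # v"
    using split_list by metis
  then have "letter k * (word w - word (u @ v)) + (word (k # u @ v) - word (u @ k # v))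
      \<in> (commutator_ideal :: 'k quotient_alg set)"
    using Cons by (intro ideal_add ideal_letter word_move_letter) auto
  then show ?case
    by (simp add: w' algebra_simps)
qed

lemma ideal_bounded:
  assumes "r \<in> commutator_ideal"
  shows "\<exists>m d. r \<in> V.span ((\<lambda>(as, w, i, j). spanner as w i j) ` indices m d)"
proof -
  let ?e = "\<lambda>(as, w, i, j). spanner as w i j"
  have mono: "V.span (?e ` indices m d) \<subseteq> V.span (?e ` indices m' d')" if "m \<le> m'" "d \<le> d'" for m d m' d'
    using that by (intro V.span_mono image_mono) (auto simp: indices_def)
  have gen: "\<exists>m d. spanner as w i j \<in> V.span (?e ` indices m d)" for as w i j
  proof -
    obtain m where m: "set as \<union> set w \<union> {i, j} \<subseteq> {..<m}"
      using finite_nat_set_iff_bounded[of "set as \<union> set w \<union> {i, j}"] by auto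
    then have "spanner as w i j \<in> shorter m (length as + length w) (Suc (length w))"
      by (intro spanner_in_shorter) auto
    also have "\<dots> \<subseteq> V.span (?e ` indices m (length as + length w))"
      unfolding shorter_def by (intro V.span_mono) (force simp: indices_def)
    finally show ?thesis by blast
  qed
  show ?thesis
    using assms unfolding commutator_ideal_def
  proof (induction rule: V.span_induct_alt)
    case base
    show ?case
      using V.span_zero by blast
  next
    case (step c y z)
    then obtain m d m' d' where "y \<in> V.span (?e ` indices m d)" "z \<in> V.span (?e ` indices m' d')"
      using gen by blast
    then have "y \<in> V.span (?e ` indices (max m m') (max d d'))" "z \<in> V.span (?e ` indices (max m m') (max d d'))"
      using mono[of m "max m m'" d "max d d'"] mono[of m' "max m m'" d' "max d d'"] by auto
    then show ?case
      by (blast intro: V.span_add V.span_scale)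
  qed
qed

text \<open>At scalar matrices a word becomes the commutative monomial of its letters, and modulo
  the commutator ideal a word is determined by these letters. The base \<open>N\<close> exceeds the
  length of every word in \<open>f\<close>, so distinct monomials get distinct exponents.\<close>

lemma weak_identity_in_ideal:
  fixes f :: "'k::field_char_0 free_alg"
  assumes f: "f \<in> weak_identities (symmetric_matrices :: ('k^2^2) set)"
  shows "quot f \<in> commutator_ideal"
proof -
  let ?W = "letters ` Poly_Mapping.keys f"
  obtain N where N: "length ` ?W \<subseteq> {..<N}"
    using finite_nat_set_iff_bounded[of "length ` ?W"] by auto
  define ev where "ev r x = row_sum (quotient_eval (\<lambda>k. x ^ (N ^ k)) (\<lambda>_. 0) (\<lambda>_. 0) r) True"
    for r :: "'k quotient_alg" and x
  have ev_add: "ev (r + r') x = ev r x + ev r' x" for r r' x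
    by (simp add: ev_def quotient_eval_simps row_sum_def)
  have ev_scale: "ev (quot (scalar c) * r) x = c * ev r x" for c r x
    by (simp add: ev_def quotient_eval_scalar row_sum_def distrib_left)
  have ev_word: "ev (word w * r) x = x ^ digit_value N (mset w) * ev r x" for w r x
  proof (induction w)
    case (Cons k w)
    have "ev (letter k * s) x = x ^ (N ^ k) * ev s x" for s
      by (simp add: ev_def row_sum_letter)
    with Cons show ?case
      by (simp add: mult.assoc power_add)
  qed simp
  have "ev 1 x = 1" for x
    by (simp add: ev_def quotient_eval_1 row_sum_def mat_def)
  then have ev_word_1: "ev (word w) x = x ^ digit_value N (mset w)" for w x
    using ev_word[of w 1 x] by simp
  show ?thesis
  proof (rule V.triangular_family[where e = word and lead = "\<lambda>w. digit_value N (mset w)" and I = ?W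
        and ev = ev and \<kappa> = id])
    show "V.subspace (commutator_ideal :: 'k quotient_alg set)"
      by (simp add: commutator_ideal_def)
    show "ev r x = 0" if "r \<in> commutator_ideal" for r x
      using that unfolding commutator_ideal_def
    proof (induction rule: V.span_induct_alt)
      case base
      show ?case
        using ev_scale[of 0 0] by simp
    next
      case (step c y z)
      then obtain as w i j where "y = spanner as w i j"
        by blast
      then have "ev y x = 0"
        by (simp add: spanner_def ev_word) (simp add: ev_def quotient_eval_jordans row_sum_def)
      then show ?case
        using step by (simp add: ev_add ev_scale)
    qed
    show "\<exists>p. degree p \<le> digit_value N (mset w) \<and> coeff p (digit_value N (mset w)) \<noteq> 0 \<and>
        (\<forall>x. ev (word w) x = poly p x)" for w
      by (intro exI[of _ "monom 1 (digit_value N (mset w))"]) (simp add: ev_word_1 poly_monom degree_monom_le)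
    show "word w - word w' \<in> V.span (commutator_ideal \<union> word ` {k \<in> ?W. digit_value N (mset k) < digit_value N (mset w)})"
      if "w \<in> ?W" "w' \<in> ?W" "digit_value N (mset w) = digit_value N (mset w')" for w w'
    proof -
      have "length v < N" if "v \<in> ?W" for v
        using N that by blast
      then have "mset w = mset w'"
        using that by (intro digit_value_inject[of _ N]) simp_all
      then show ?thesis
        by (intro V.span_base UnI1 word_mset)
    qed
    have "quot f = (\<Sum>w\<in>Poly_Mapping.keys f. quot (scalar (Poly_Mapping.lookup f w)) * word (letters w))"
    proof -
      have sum: "quot (\<Sum>w\<in>A. h w) = (\<Sum>w\<in>A. quot (h w))" for A and h :: "free_monoid \<Rightarrow> 'k free_alg"
        by (induction A rule: infinite_finite_induct) (simp_all add: quot_simps)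
      have "quot (prod_list (map X xs)) = (word xs :: 'k quotient_alg)" for xs
        by (induction xs) (simp_all add: quot_simps letter_def)
      moreover have "quot f = quot (\<Sum>w\<in>Poly_Mapping.keys f. Poly_Mapping.single w (Poly_Mapping.lookup f w))"
        by (simp only: sum_singles)
      ultimately show ?thesis
        by (simp add: sum single_eq_scalar_mult_word quot_simps)
    qed
    also have "\<dots> \<in> V.span (commutator_ideal \<union> word ` ?W)"
      by (intro V.span_sum V.span_scale V.span_base) auto
    finally show "quot f \<in> V.span (commutator_ideal \<union> word ` ?W)" .
    show "ev (quot f) x = 0" for x
      using weak_identity_constant_diagonal[OF f]
      by (simp add: ev_def quotient_eval_quot row_sum_def)
  qed (use ev_add ev_scale in simp_all)
qed

theorem mainTheorem1:
  "weak_T_ideal {standard_poly 4, metabelian_poly} =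
     weak_identities (symmetric_matrices :: ('k::field_char_0^2^2) set)"
proof (rule antisym[OF weak_T_ideal_subset subsetI])
  fix f :: "'k free_alg"
  assume f: "f \<in> weak_identities (symmetric_matrices :: ('k^2^2) set)"
  obtain m d where md: "quot f \<in> V.span ((\<lambda>(as, w, i, j). spanner as w i j) ` indices m d)"
    using ideal_bounded[OF weak_identity_in_ideal[OF f]] by blast
  have "generic_row N m (quot f) x = 0" for N x
    using weak_identity_constant_diagonal[OF f]
    by (simp add: generic_row_def quotient_eval_quot row_sum_def)
  then have "quot f = 0"
    by (intro generic_row_injective[OF md, of "2 * d + 5"]) simp_all
  then show "f \<in> symmetric_ideal"
    by (simp add: quot_eq_0_iff)
qed

end
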